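(* Let $n\ge 5$ be an integer. Then $ex_{\mathcal{P}}(n,C_4^+)=ex_{\mathcal{P}}(n,C_4)$ if $n\ne 8$, and $ex_{\mathcal{P}}(8,C_4^+)=ex_{\mathcal{P}}(8,C_4)+1=12$.
   Context: All graphs are finite and simple. $C_4$ is the cycle on 4 vertices, and $C_4^+$ is the graph obtained from $C_4$ by adding exactly one pendant edge (joining a new vertex) to a vertex of degree two. For a graph $H$, $ex_{\mathcal{P}}(n,H)$ is the maximum number of edges in a planar graph on $n$ vertices that does not contain $H$ as a subgraph. *)

theory Defs
  imports "HOL-Analysis.Analysis"
begin

record 'a ugraph =
  verts :: "'a set"
  edges :: "'a set set"

definition simple_graph :: "'a ugraph \<Rightarrow> bool" where
  "simple_graph G \<longleftrightarrow> finite (verts G) \<and> (\<forall>e\<in>edges G. e \<subseteq> verts G \<and> card e = 2)"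

text \<open>Subgraph containment is up to isomorphism and not necessarily induced.\<close>

definition contains_subgraph :: "'a ugraph \<Rightarrow> 'b ugraph \<Rightarrow> bool" where
  "contains_subgraph G H \<longleftrightarrow>
     (\<exists>f. inj_on f (verts H) \<and> f ` verts H \<subseteq> verts G \<and> (\<forall>e\<in>edges H. f ` e \<in> edges G))"

text \<open>
  A drawing in the plane: vertex v is placed at the point p v, and edge e is drawn as the
  Jordan arc c e joining the points of its two ends. An arc passes through no other vertex, and
  two arcs meet at most in the point of a common end.
\<close>

definition plane_drawing ::
  "'a ugraph \<Rightarrow> ('a \<Rightarrow> complex) \<Rightarrow> ('a set \<Rightarrow> real \<Rightarrow> complex) \<Rightarrow> bool" where
  "plane_drawing G p c \<longleftrightarrow>
     inj_on p (verts G) \<and>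
     (\<forall>e\<in>edges G. arc (c e) \<and> {pathstart (c e), pathfinish (c e)} = p ` e \<and>
                  path_image (c e) \<inter> p ` verts G = p ` e) \<and>
     (\<forall>e\<in>edges G. \<forall>e'\<in>edges G. e \<noteq> e' \<longrightarrow>
        path_image (c e) \<inter> path_image (c e') = p ` (e \<inter> e'))"

definition planar :: "'a ugraph \<Rightarrow> bool" where
  "planar G \<longleftrightarrow> (\<exists>p c. plane_drawing G p c)"

text \<open>
  Vertices are taken to be natural numbers, which loses nothing for finite graphs.
  The set of edge counts is finite, and it is nonempty whenever H has an edge (see below),
  so that the maximum is attained.
\<close>

definition planar_free_sizes :: "nat \<Rightarrow> 'b ugraph \<Rightarrow> nat set" where
  "planar_free_sizes n H =
     {card (edges G) | G :: nat ugraph.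
        simple_graph G \<and> planar G \<and> card (verts G) = n \<and> \<not> contains_subgraph G H}"

definition ex_planar :: "nat \<Rightarrow> 'b ugraph \<Rightarrow> nat" where
  "ex_planar n H = Max (planar_free_sizes n H)"

definition C4 :: "nat ugraph" where
  "C4 = \<lparr>verts = {0, 1, 2, 3}, edges = {{0, 1}, {1, 2}, {2, 3}, {3, 0}}\<rparr>"

definition C4_plus :: "nat ugraph" where
  "C4_plus = \<lparr>verts = insert 4 (verts C4), edges = insert {0, 4} (edges C4)\<rparr>"

lemma finite_planar_free_sizes: "finite (planar_free_sizes n H)"
proof (rule finite_subset)
  show "planar_free_sizes n H \<subseteq> {..2 ^ n}"
  proof
    fix m assume "m \<in> planar_free_sizes n H"
    then obtain G :: "nat ugraph" where G: "m = card (edges G)" "simple_graph G" "card (verts G) = n"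
      unfolding planar_free_sizes_def by blast
    then have "edges G \<subseteq> Pow (verts G)" "finite (verts G)"
      by (auto simp: simple_graph_def)
    then have "card (edges G) \<le> card (Pow (verts G))"
      by (intro card_mono) auto
    then show "m \<in> {..2 ^ n}"
      using G \<open>finite (verts G)\<close> by (simp add: card_Pow)
  qed
qed simp

lemma planar_free_sizes_nonempty:
  assumes "edges H \<noteq> {}"
  shows "planar_free_sizes n H \<noteq> {}"
proof -
  let ?G = "\<lparr>verts = {..<n}, edges = {}\<rparr> :: nat ugraph"
  have "plane_drawing ?G of_nat c" for c
    by (auto simp: plane_drawing_def inj_on_def)
  then have "planar ?G"
    by (auto simp: planar_def)
  moreover have "simple_graph ?G" "card (verts ?G) = n" "\<not> contains_subgraph ?G H"
    using assms by (auto simp: simple_graph_def contains_subgraph_def)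
  ultimately show ?thesis
    unfolding planar_free_sizes_def by blast
qed

end

theory Submission
  imports Defs
begin

text \<open>
  In a C4-plus-free graph no edge leaves the vertex set of a 4-cycle, so every 4-cycle spans a
  component with 4 vertices and at most 6 edges. Conversely, two triangles attached at
  a vertex of a planar C4-free graph give a planar C4-free graph with 4 more vertices and 6 more
  edges. Hence 4-cycles do not pay, by induction on n, unless all vertices are used up by copies of
  K4. For n = 8 this gives the exception 2K4; for n = 12 the truncated tetrahedron is as good as 3K4,
  and it takes over from there.

  A triangle can be attached at a vertex of a topological drawing because the arcs can be redrawn
  as radii in a small disc around it.
\<close>

section \<open>Modifying plane drawings\<close>

text \<open>The two extremal numbers are compared directly, without a formula for either; only n = 8
  needs actual values. The comparison works because K4 and a pair of attached triangles have the
  same rate, 6 edges for 4 vertices, so exchanging one for the other loses nothing. The exchange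
  needs a vertex to attach to and a C4-free competitor on the other n - 4 vertices. For n = 4 no
  vertex is left over, and for n = 8 the other four vertices may form a K4, which has no C4-free
  competitor. For n = 12 the bound is 12 + 6 = 18, which a cubic graph attains. The upper bound 11
  for C4-free graphs on 8 vertices rests on the fact that two vertices have at most one common
  neighbour. Counting alone just fails to exclude 12 edges: it leaves one degree-4 configuration and
  the cubic graphs, and both are ruled out by their structure.\<close>

lemma plane_drawingI:
  assumes "inj_on p (verts G)"
    and "\<And>e. e \<in> edges G \<Longrightarrow> arc (c e)"
    and "\<And>e. e \<in> edges G \<Longrightarrow> {pathstart (c e), pathfinish (c e)} = p ` e"
    and "\<And>e. e \<in> edges G \<Longrightarrow> e \<subseteq> verts G"
    and "\<And>e. e \<in> edges G \<Longrightarrow> path_image (c e) \<inter> p ` verts G \<subseteq> p ` e"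
    and "\<And>e e'. \<lbrakk>e \<in> edges G; e' \<in> edges G; e \<noteq> e'\<rbrakk> \<Longrightarrow>
           path_image (c e) \<inter> path_image (c e') \<subseteq> p ` (e \<inter> e')"
  shows "plane_drawing G p c"
proof -
  \<comment> \<open>An arc contains its ends, so of the equations in \<open>plane_drawing\<close>
    only the inclusions from left to right need checking.\<close>
  have ends: "p ` e \<subseteq> path_image (c e)" if "e \<in> edges G" for e
    unfolding assms(3)[OF that, symmetric]
    by (simp add: pathstart_in_path_image pathfinish_in_path_image)
  show ?thesis
    unfolding plane_drawing_def
  proof (intro conjI ballI impI)
    show "path_image (c e) \<inter> p ` verts G = p ` e" if "e \<in> edges G" for e
      using assms(4,5)[OF that] ends[OF that] by blast
    show "path_image (c e) \<inter> path_image (c e') = p ` (e \<inter> e')"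
      if "e \<in> edges G" "e' \<in> edges G" "e \<noteq> e'" for e e'
      using assms(6)[OF that] ends[OF that(1)] ends[OF that(2)] by blast
  qed (use assms(1-3) in blast)+
qed

lemma plane_drawingD:
  assumes "plane_drawing G p c"
  shows "inj_on p (verts G)"
    and "e \<in> edges G \<Longrightarrow> arc (c e)"
    and "e \<in> edges G \<Longrightarrow> {pathstart (c e), pathfinish (c e)} = p ` e"
    and "e \<in> edges G \<Longrightarrow> path_image (c e) \<inter> p ` verts G = p ` e"
    and "\<lbrakk>e \<in> edges G; e' \<in> edges G; e \<noteq> e'\<rbrakk> \<Longrightarrow>
           path_image (c e) \<inter> path_image (c e') = p ` (e \<inter> e')"
  using assms by (simp_all add: plane_drawing_def)

lemma planar_subgraph:
  assumes "planar G" "verts H \<subseteq> verts G" "edges H \<subseteq> edges G" "simple_graph H"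
  shows "planar H"
proof -
  obtain p c where d: "plane_drawing G p c"
    using assms by (auto simp: planar_def)
  note D = plane_drawingD[OF d]
  have "plane_drawing H p c"
  proof (rule plane_drawingI)
    show "inj_on p (verts H)" using D(1) assms(2) by (rule inj_on_subset)
    show "arc (c e)" "{pathstart (c e), pathfinish (c e)} = p ` e" if "e \<in> edges H" for e
      using D(2,3)[of e] that assms(3) by auto
    show "e \<subseteq> verts H" if "e \<in> edges H" for e
      using assms(4) that by (auto simp: simple_graph_def)
    show "path_image (c e) \<inter> p ` verts H \<subseteq> p ` e" if "e \<in> edges H" for e
      using D(4)[of e] that assms(2,3) by blast
    show "path_image (c e) \<inter> path_image (c e') \<subseteq> p ` (e \<inter> e')"
      if "e \<in> edges H" "e' \<in> edges H" "e \<noteq> e'" for e e'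
      using D(5)[of e e'] that assms(3) by blast
  qed
  then show ?thesis by (auto simp: planar_def)
qed

lemma plane_drawing_insert_vertex:
  assumes "plane_drawing G p c" "\<And>e. e \<in> edges G \<Longrightarrow> e \<subseteq> verts G" "x \<notin> verts G"
    and "q \<notin> p ` verts G" "\<And>e. e \<in> edges G \<Longrightarrow> q \<notin> path_image (c e)"
  shows "plane_drawing \<lparr>verts = insert x (verts G), edges = edges G\<rparr> (p(x := q)) c"
proof -
  note D = plane_drawingD[OF assms(1)]
  have im: "p(x := q) ` A = p ` A" if "A \<subseteq> verts G" for A
    using that assms(3) by auto
  have "inj_on (p(x := q)) (insert x (verts G))"
    using D(1) assms(3,4) unfolding inj_on_def by auto
  moreover have "p(x := q) ` insert x (verts G) = insert q (p ` verts G)"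
    using assms(3) im[of "verts G"] by simp
  moreover have "p(x := q) ` (e \<inter> e') = p ` (e \<inter> e')" "p(x := q) ` e = p ` e" if "e \<in> edges G" for e e'
    using im assms(2)[OF that] by blast+
  ultimately show ?thesis
  proof (intro plane_drawingI, goal_cases)
    case (4 e)
    then show ?case using assms(2)[of e] by auto
  next
    case (5 e)
    then show ?case using D(4)[of e] assms(5)[of e] by auto
  qed (use D in simp_all)
qed

lemma plane_drawing_insert_edge:
  assumes "plane_drawing G p c" "\<And>e. e \<in> edges G \<Longrightarrow> e \<subseteq> verts G" "e0 \<notin> edges G" "e0 \<subseteq> verts G"
    and "arc \<gamma>" "{pathstart \<gamma>, pathfinish \<gamma>} = p ` e0" "path_image \<gamma> \<inter> p ` verts G \<subseteq> p ` e0"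
    and "\<And>e. e \<in> edges G \<Longrightarrow> path_image \<gamma> \<inter> path_image (c e) \<subseteq> p ` (e0 \<inter> e)"
  shows "plane_drawing \<lparr>verts = verts G, edges = insert e0 (edges G)\<rparr> p (c(e0 := \<gamma>))"
proof -
  note D = plane_drawingD[OF assms(1)]
  show ?thesis
  proof (rule plane_drawingI, goal_cases)
    case 1
    then show ?case using D(1) by simp
  next
    case (2 e)
    then show ?case using D(2)[of e] assms(5) by (cases "e = e0") simp_all
  next
    case (3 e)
    then show ?case using D(3)[of e] assms(6) by (cases "e = e0") simp_all
  next
    case (4 e)
    then show ?case using assms(2)[of e] assms(4) by (cases "e = e0") simp_all
  next
    case (5 e)
    then show ?case using D(4)[of e] assms(7) by (cases "e = e0") simp_all
  next
    case (6 e e')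
    then show ?case
      using D(5)[of e e'] assms(8)[of e] assms(8)[of e']
      by (cases "e = e0"; cases "e' = e0") (simp_all add: Int_commute)
  qed
qed

text \<open>The new arc follows g from the last time it leaves the disc.\<close>

lemma arc_redraw_radial:
  fixes g :: "real \<Rightarrow> 'a::euclidean_space"
  assumes g: "arc g" "pathstart g = a" "pathfinish g \<notin> cball a r" and r: "r > 0"
  obtains q h where "q \<in> sphere a r" "q \<in> path_image g" "arc h" "pathstart h = a"
    "pathfinish h = pathfinish g" "path_image h \<subseteq> closed_segment a q \<union> (path_image g - cball a r)"
proof -
  have contg: "continuous_on {0..1} g"
    using g arc_imp_path path_def by blast
  define T where "T = {t \<in> {0..1}. g t \<in> cball a r}"
  have "closed T"
    unfolding T_def using continuous_closed_preimage[OF contg, of "cball a r"]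
    by (simp add: vimage_def Int_def)
  then have "compact T"
    unfolding T_def by (metis (no_types, lifting) bounded_closed_interval bounded_subset compact_eq_bounded_closed mem_Collect_eq subsetI)
  moreover have "0 \<in> T"
    using g r by (auto simp: T_def pathstart_def)
  ultimately obtain t where t: "t \<in> T" "\<And>u. u \<in> T \<Longrightarrow> u \<le> t"
    using compact_attains_sup[of T] by blast
  have t01: "0 \<le> t" "t \<le> 1" and "g t \<in> cball a r"
    using t by (auto simp: T_def)
  moreover have "t \<noteq> 1"
    using g(3) \<open>g t \<in> cball a r\<close> by (auto simp: pathfinish_def)
  ultimately have t1: "t < 1" by simp
  \<comment> \<open>If \<open>g t\<close> were in the open ball, continuity would keep the curve in
    the disc a little longer, against the choice of \<open>t\<close> as the last time there.\<close>
  have "\<not> dist a (g t) < r"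
  proof
    assume "dist a (g t) < r"
    then obtain d where d: "d > 0" "\<And>u. u \<in> {0..1} \<Longrightarrow> dist u t < d \<Longrightarrow> dist (g u) (g t) < r - dist a (g t)"
      using contg t01 unfolding continuous_on_iff by (metis atLeastAtMost_iff diff_gt_0_iff_gt)
    define u where "u = min 1 (t + d/2)"
    have u: "u \<in> {0..1}" "dist u t < d" "u > t"
      using d(1) t01 t1 by (auto simp: u_def dist_real_def)
    have "dist a (g u) \<le> r"
      using d(2)[OF u(1,2)] dist_triangle[of a "g u" "g t"] by (simp add: dist_commute)
    then have "u \<in> T" using u by (simp add: T_def)
    then show False using t(2) u(3) by fastforce
  qed
  then have sph: "g t \<in> sphere a r" using \<open>g t \<in> cball a r\<close> by simp
  have out: "g u \<notin> cball a r" if "t < u" "u \<le> 1" for u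
    using t(2)[of u] that t01 by (auto simp: T_def)
  define h where "h = linepath a (g t) +++ subpath t 1 g"
  have im2: "path_image (subpath t 1 g) \<subseteq> insert (g t) (path_image g - cball a r)"
  proof
    fix x assume "x \<in> path_image (subpath t 1 g)"
    then obtain u where "u \<in> {t..1}" "x = g u"
      using t1 by (auto simp: path_image_subpath)
    then show "x \<in> insert (g t) (path_image g - cball a r)"
      using out[of u] t01 by (cases "u = t") (auto simp: path_image_def)
  qed
  have seg: "closed_segment a (g t) \<subseteq> cball a r"
    using \<open>g t \<in> cball a r\<close> r by (simp add: closed_segment_subset)
  have "a \<noteq> g t" using sph r by auto
  have "arc h"
    unfolding h_def
  proof (rule arc_join)
    show "arc (linepath a (g t))" using \<open>a \<noteq> g t\<close> by simp
    show "arc (subpath t 1 g)"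
      using g t01 t1 by (intro arc_subpath_arc) auto
    show "path_image (linepath a (g t)) \<inter> path_image (subpath t 1 g) \<subseteq> {pathstart (subpath t 1 g)}"
      using im2 seg by auto
  qed (simp add: pathstart_def subpath_def)
  moreover have "path_image h \<subseteq> closed_segment a (g t) \<union> (path_image g - cball a r)"
    unfolding h_def using im2 path_image_join_subset[of "linepath a (g t)" "subpath t 1 g"] by auto
  moreover have "pathstart h = a" "pathfinish h = pathfinish g"
    by (simp_all add: h_def pathfinish_def subpath_def joinpaths_def pathstart_def linepath_def)
  moreover have "g t \<in> path_image g" using t01 by (simp add: path_image_def)
  ultimately show ?thesis using that sph by blast
qed

text \<open>The distance from \<open>a\<close> determines the parameter of a point on a radius, so a
  common point has the same parameter on both; if it is nonzero, the radii end in the same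
  point.\<close>

lemma closed_segment_radii_Int:
  fixes a :: "'a::euclidean_space"
  assumes "q \<in> sphere a r" "q' \<in> sphere a r" "q \<noteq> q'" "r > 0"
  shows "closed_segment a q \<inter> closed_segment a q' \<subseteq> {a}"
proof
  fix x assume "x \<in> closed_segment a q \<inter> closed_segment a q'"
  then obtain s t where s: "x = (1-s) *\<^sub>R a + s *\<^sub>R q" "0 \<le> s" and t: "x = (1-t) *\<^sub>R a + t *\<^sub>R q'" "0 \<le> t"
    unfolding Int_iff in_segment by blast
  have s': "x - a = s *\<^sub>R (q - a)" using s by (simp add: algebra_simps)
  have t': "x - a = t *\<^sub>R (q' - a)" using t by (simp add: algebra_simps)
  have "norm (q - a) = r" "norm (q' - a) = r"
    using assms by (auto simp: dist_norm norm_minus_commute)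
  then have "s * r = t * r"
    using s(2) t(2) s' t' by (metis abs_of_nonneg norm_scaleR)
  then have "s = t" using assms(4) by simp
  show "x \<in> {a}"
  proof (rule ccontr)
    assume "x \<notin> {a}"
    then have "s \<noteq> 0" using s' by auto
    then show False using s' t' \<open>s = t\<close> assms(3) by simp
  qed
qed

text \<open>Twice the signed area of the triangle a b c. Being affine in \<open>c\<close> and zero
  on the line through \<open>a\<close> and \<open>b\<close>, its sign tells the two sides of that
  line apart.\<close>

definition orient :: "complex \<Rightarrow> complex \<Rightarrow> complex \<Rightarrow> real" where
  "orient a b c = (Re b - Re a) * (Im c - Im a) - (Im b - Im a) * (Re c - Re a)"

lemma orient_affine:
  "orient a b ((1 - t) *\<^sub>R c + t *\<^sub>R d) = (1 - t) * orient a b c + t * orient a b d"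
  by (simp add: orient_def algebra_simps)

lemma orient_degenerate [simp]: "orient a b a = 0" "orient a b b = 0"
  by (simp_all add: orient_def)

lemma orient_closed_segment: "x \<in> closed_segment a b \<Longrightarrow> orient a b x = 0"
  by (auto simp: in_segment orient_affine)

lemma closed_segment_Int_common_end:
  assumes "orient a b c \<noteq> 0"
  shows "closed_segment a b \<inter> closed_segment a c \<subseteq> {a}"
proof
  fix x assume x: "x \<in> closed_segment a b \<inter> closed_segment a c"
  then obtain t where t: "x = (1 - t) *\<^sub>R a + t *\<^sub>R c"
    by (auto simp: in_segment)
  have "t * orient a b c = 0"
    using x orient_closed_segment[of x a b] by (simp add: t orient_affine)
  then show "x \<in> {a}" using assms t by simp
qed

lemma closed_segment_Int_same_side:
  assumes "orient a b c * orient a b d > 0"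
  shows "closed_segment a b \<inter> closed_segment c d = {}"
proof (rule ccontr)
  assume "\<not> ?thesis"
  then obtain x t where x: "x \<in> closed_segment a b" and t: "x = (1 - t) *\<^sub>R c + t *\<^sub>R d" "0 \<le> t" "t \<le> 1"
    unfolding disjoint_iff in_segment(1)[of _ c d] by blast
  have *: "(1 - t) * orient a b c + t * orient a b d = 0"
    using orient_closed_segment[OF x] by (simp add: t orient_affine)
  \<comment> \<open>Multiplying by \<open>orient a b c\<close> turns both terms into nonnegative
    ones, which avoids a case distinction on the side.\<close>
  have "(1 - t) * (orient a b c * orient a b c) + t * (orient a b c * orient a b d)
      = orient a b c * ((1 - t) * orient a b c + t * orient a b d)"
    by (simp add: algebra_simps)
  also have "\<dots> = 0" by (simp add: *)
  finally have **: "(1 - t) * (orient a b c * orient a b c) + t * (orient a b c * orient a b d) = 0" .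
  have "orient a b c \<noteq> 0" using assms by auto
  then have "orient a b c * orient a b c > 0" by (auto simp: zero_less_mult_iff linorder_neq_iff)
  then show False
    using ** assms t(2,3)
    by (smt (verit) mult_nonneg_nonneg mult_pos_pos)
qed

section \<open>A free cone at a vertex, and a triangle drawn into it\<close>

lemma simple_graph_finite:
  assumes "simple_graph G"
  shows "finite (verts G)" "finite (edges G)"
proof -
  show "finite (verts G)" using assms by (simp add: simple_graph_def)
  moreover have "edges G \<subseteq> Pow (verts G)" using assms by (auto simp: simple_graph_def)
  ultimately show "finite (edges G)" by (meson finite_Pow_iff finite_subset)
qed

text \<open>The arcs at v are made radial in a small disc around v; there are finitely many radii, so a
  cone at v whose slopes exceed all of theirs is free.\<close>

lemma plane_drawing_free_sector:
  assumes d: "plane_drawing G p c" and G: "simple_graph G" and v: "v \<in> verts G"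
  obtains c' s r where "plane_drawing G p c'" "r > 0"
    "\<And>z. \<lbrakk>Re (z - p v) > 0; Im (z - p v) > s * Re (z - p v); z \<in> cball (p v) r\<rbrakk>
      \<Longrightarrow> z \<notin> p ` verts G \<and> (\<forall>e\<in>edges G. z \<notin> path_image (c' e))"
proof -
  note D = plane_drawingD[OF d]
  have sub: "e \<subseteq> verts G" "card e = 2" if "e \<in> edges G" for e
    using G that by (auto simp: simple_graph_def)
  define a where "a = p v"
  \<comment> \<open>The disc has to miss everything that is not incident with \<open>v\<close>;
    \<open>B\<close> is closed as a finite union of points and arcs.\<close>
  define B where "B = p ` (verts G - {v}) \<union> (\<Union>e\<in>{e\<in>edges G. v \<notin> e}. path_image (c e))"
  have "a \<notin> path_image (c e)" if "e \<in> edges G" "v \<notin> e" for e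
  proof
    assume "a \<in> path_image (c e)"
    then have "p v \<in> p ` e" using D(4)[OF that(1)] v by (auto simp: a_def)
    then show False using D(1) sub[OF that(1)] that(2) v by (auto simp: inj_on_def)
  qed
  moreover have "a \<notin> p ` (verts G - {v})"
    using D(1) v by (auto simp: inj_on_def a_def)
  ultimately have "a \<in> - B" by (auto simp: B_def)
  moreover have "closed B"
    unfolding B_def using simple_graph_finite[OF G] D(2)
    by (intro closed_Un closed_UN finite_imp_closed) (auto intro: closed_arc_image)
  ultimately obtain r where r: "r > 0" "cball a r \<subseteq> - B"
    using open_contains_cball_eq[of "- B" ] by auto
  have "\<exists>q h. q \<in> sphere a r \<and> q \<in> path_image (c e) \<and> arc h \<and> {pathstart h, pathfinish h} = p ` e \<and>
          path_image h \<subseteq> closed_segment a q \<union> (path_image (c e) - cball a r)"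
    if e: "e \<in> edges G" "v \<in> e" for e
  proof -
    obtain w where w: "e = {v, w}" "w \<noteq> v"
      using sub[OF e(1)] e(2) by (auto simp: card_2_iff)
    have "p w \<notin> cball a r"
      using r(2) w sub[OF e(1)] by (auto simp: B_def)
    \<comment> \<open>The given arc may run towards \<open>v\<close>; it is then reversed.\<close>
    obtain g where g: "arc g" "pathstart g = a" "pathfinish g = p w" "path_image g = path_image (c e)"
    proof (cases "pathstart (c e) = a")
      case True
      then have "pathfinish (c e) = p w"
        using D(2,3)[OF e(1)] w arc_distinct_ends[of "c e"] by (auto simp: a_def doubleton_eq_iff)
      then show ?thesis using that[of "c e"] True D(2)[OF e(1)] by simp
    next
      case False
      then have "pathfinish (c e) = a" "pathstart (c e) = p w"
        using D(3)[OF e(1)] w by (auto simp: a_def doubleton_eq_iff)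
      then show ?thesis
        using that[of "reversepath (c e)"] D(2)[OF e(1)] by (simp add: arc_reversepath)
    qed
    obtain q h where "q \<in> sphere a r" "q \<in> path_image g" "arc h" "pathstart h = a"
      "pathfinish h = p w" "path_image h \<subseteq> closed_segment a q \<union> (path_image g - cball a r)"
      using arc_redraw_radial[OF g(1,2) _ r(1)] g(3) \<open>p w \<notin> cball a r\<close> by metis
    then show ?thesis using g(4) w by (intro exI[of _ q] exI[of _ h]) (simp add: a_def)
  qed
  then obtain q h where "\<forall>e. e \<in> edges G \<and> v \<in> e \<longrightarrow> q e \<in> sphere a r \<and> q e \<in> path_image (c e) \<and>
      arc (h e) \<and> {pathstart (h e), pathfinish (h e)} = p ` e \<and>
      path_image (h e) \<subseteq> closed_segment a (q e) \<union> (path_image (c e) - cball a r)"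
    by metis
  then have qh: "q e \<in> sphere a r" "q e \<in> path_image (c e)" "arc (h e)"
      "{pathstart (h e), pathfinish (h e)} = p ` e"
      "path_image (h e) \<subseteq> closed_segment a (q e) \<union> (path_image (c e) - cball a r)"
    if "e \<in> edges G" "v \<in> e" for e
    using that by simp_all
  define c' where "c' = (\<lambda>e. if v \<in> e then h e else c e)"
  have far: "path_image (c e) \<inter> cball a r = {}" if "e \<in> edges G" "v \<notin> e" for e
    using r(2) that by (auto simp: B_def)
  have seg: "closed_segment a (q e) \<subseteq> cball a r" if "e \<in> edges G" "v \<in> e" for e
    using qh(1)[OF that] r(1) by (intro closed_segment_subset) auto
  have vert: "p ` verts G \<inter> cball a r = {a}"
    using r v by (auto simp: B_def a_def)
  have "plane_drawing G p c'"
  proof (rule plane_drawingI)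
    show "inj_on p (verts G)" by (rule D)
    show "arc (c' e)" "{pathstart (c' e), pathfinish (c' e)} = p ` e" if "e \<in> edges G" for e
      using D(2,3)[OF that] qh(3,4)[OF that] by (simp_all add: c'_def)
    show "e \<subseteq> verts G" if "e \<in> edges G" for e
      using sub that by blast
    show "path_image (c' e) \<inter> p ` verts G \<subseteq> p ` e" if e: "e \<in> edges G" for e
    proof (cases "v \<in> e")
      case True
      have "a \<in> p ` e" using True by (simp add: a_def)
      then show ?thesis
        using qh(5)[OF e True] seg[OF e True] vert D(4)[OF e] True by (simp add: c'_def) blast
    next
      case False
      then show ?thesis using D(4)[OF e] by (simp add: c'_def)
    qed
    show "path_image (c' e) \<inter> path_image (c' e') \<subseteq> p ` (e \<inter> e')"
      if e: "e \<in> edges G" "e' \<in> edges G" "e \<noteq> e'" for e e'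
    proof -
      note De = D(5)[OF e]
      consider "v \<in> e" "v \<in> e'" | "v \<in> e" "v \<notin> e'" | "v \<notin> e" "v \<in> e'" | "v \<notin> e" "v \<notin> e'" by blast
      then show ?thesis
      proof cases
        case 1
        have "e \<inter> e' = {v}"
        proof -
          obtain u u' where "e = {v, u}" "e' = {v, u'}"
            using 1 sub(2)[OF e(1)] sub(2)[OF e(2)] by (auto simp: card_2_iff)
          then show ?thesis using e(3) by auto
        qed
        then have "path_image (c e) \<inter> path_image (c e') = {a}"
          using De by (simp add: a_def)
        \<comment> \<open>The points \<open>q e\<close> and \<open>q e'\<close> lie on the original
          arcs, which meet only in \<open>a\<close>, so distinct edges receive distinct
          radii.\<close>
        moreover have "q e \<noteq> a" "q e' \<noteq> a"
          using qh(1)[OF e(1) 1(1)] qh(1)[OF e(2) 1(2)] r(1) by auto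
        ultimately have "q e \<noteq> q e'"
          using qh(2)[OF e(1) 1(1)] qh(2)[OF e(2) 1(2)] by (metis IntI singletonD)
        then have "closed_segment a (q e) \<inter> closed_segment a (q e') \<subseteq> {a}"
          using closed_segment_radii_Int[OF qh(1)[OF e(1) 1(1)] qh(1)[OF e(2) 1(2)] _ r(1)] by simp
        then show ?thesis
          using \<open>path_image (c e) \<inter> path_image (c e') = {a}\<close> \<open>e \<inter> e' = {v}\<close>
            qh(5)[OF e(1) 1(1)] qh(5)[OF e(2) 1(2)] seg[OF e(1) 1(1)] seg[OF e(2) 1(2)] 1
          unfolding c'_def by (simp add: a_def[symmetric]) blast
      next
        case 2
        then show ?thesis
          using De qh(5)[OF e(1) 2(1)] seg[OF e(1) 2(1)] far[OF e(2) 2(2)]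
          by (simp add: c'_def) blast
      next
        case 3
        then show ?thesis
          using De qh(5)[OF e(2) 3(2)] seg[OF e(2) 3(2)] far[OF e(1) 3(1)]
          by (simp add: c'_def) blast
      next
        case 4
        then show ?thesis using De by (simp add: c'_def)
      qed
    qed
  qed
  moreover
  \<comment> \<open>Only radii with positive real part can enter the cone, so it is harmless that
    the quotient is 0 for vertical ones. The extra 0 keeps \<open>S\<close> nonempty when there are
    no edges.\<close>
  define S where "S = insert 0 ((\<lambda>e. Im (q e - a) / Re (q e - a)) ` edges G)"
  define s where "s = Max S"
  have slope: "Im (q e - a) / Re (q e - a) \<le> s" if "e \<in> edges G" for e
    unfolding s_def using simple_graph_finite[OF G] that by (intro Max_ge) (auto simp: S_def)
  have "z \<notin> p ` verts G \<and> (\<forall>e\<in>edges G. z \<notin> path_image (c' e))"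
    if z: "Re (z - a) > 0" "Im (z - a) > s * Re (z - a)" "z \<in> cball a r" for z
  proof (intro conjI ballI)
    show "z \<notin> p ` verts G" using vert z by auto
    show "z \<notin> path_image (c' e)" if e: "e \<in> edges G" for e
    proof (cases "v \<in> e")
      case True
      have "z \<notin> closed_segment a (q e)"
      proof
        assume "z \<in> closed_segment a (q e)"
        then obtain t where t: "0 \<le> t" "z = (1 - t) *\<^sub>R a + t *\<^sub>R q e"
          by (auto simp: in_segment)
        have za: "Re (z - a) = t * Re (q e - a)" "Im (z - a) = t * Im (q e - a)"
          by (simp_all add: t algebra_simps)
        then have "t > 0" "Re (q e - a) > 0"
          using z(1) t(1) by (auto simp: zero_less_mult_iff)
        then have "Im (q e - a) \<le> s * Re (q e - a)"
          using slope[OF e] by (simp add: pos_divide_le_eq)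
        then have "t * Im (q e - a) \<le> t * (s * Re (q e - a))"
          using t(1) by (rule mult_left_mono)
        then show False using z(2) za by (simp add: mult.left_commute)
      qed
      then show ?thesis using qh(5)[OF e True] z(3) True by (auto simp: c'_def)
    next
      case False
      then show ?thesis using far[OF e] z(3) by (auto simp: c'_def)
    qed
  qed
  ultimately show ?thesis
    using that[of c' r s] r(1) unfolding a_def by blast
qed

text \<open>The new vertices are placed at \<open>b\<close> and \<open>w\<close>, on rays from
  \<open>a\<close> of slopes s + 1 and s + 2 and on a common vertical line. Slopes along the third
  side then lie between these two, so the whole triangle except its apex \<open>a\<close> lies in
  the free cone \<open>K\<close>.\<close>

lemma planar_attach_triangle:
  assumes "planar G" and G: "simple_graph G" and v: "v \<in> verts G"
    and xy: "x \<notin> verts G" "y \<notin> verts G" "x \<noteq> y"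
  shows "planar \<lparr>verts = {x, y} \<union> verts G, edges = {{v, x}, {v, y}, {x, y}} \<union> edges G\<rparr>"
proof -
  obtain p c0 where "plane_drawing G p c0" using assms(1) by (auto simp: planar_def)
  then obtain c s r where d: "plane_drawing G p c" and r: "r > 0"
    and free: "\<And>z. \<lbrakk>Re (z - p v) > 0; Im (z - p v) > s * Re (z - p v); z \<in> cball (p v) r\<rbrakk>
      \<Longrightarrow> z \<notin> p ` verts G \<and> (\<forall>e\<in>edges G. z \<notin> path_image (c e))"
    using plane_drawing_free_sector[OF _ G v] by metis
  note D = plane_drawingD[OF d]
  have sub: "e \<subseteq> verts G" if "e \<in> edges G" for e
    using G that by (auto simp: simple_graph_def)
  define a where "a = p v"
  define K where "K = {z. Re (z - a) > 0 \<and> Im (z - a) > s * Re (z - a) \<and> z \<in> cball a r}"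
  \<comment> \<open>The denominator bounds both norms, so \<open>t\<close> times either is at most
    \<open>r\<close>; the summand 1 makes it visibly positive.\<close>
  define t where "t = r / (1 + cmod (Complex 1 (s + 1)) + cmod (Complex 1 (s + 2)))"
  define b where "b = a + t *\<^sub>R Complex 1 (s + 1)"
  define w where "w = a + t *\<^sub>R Complex 1 (s + 2)"
  have t: "t > 0" unfolding t_def using r by (intro divide_pos_pos) (simp_all add: add_pos_nonneg)
  have "t * (1 + cmod (Complex 1 (s + 1)) + cmod (Complex 1 (s + 2))) = r"
    unfolding t_def by (smt (verit) nonzero_eq_divide_eq norm_ge_zero)
  then have "t + t * cmod (Complex 1 (s + 1)) + t * cmod (Complex 1 (s + 2)) = r"
    by (simp add: algebra_simps)
  moreover have "0 \<le> t * cmod (Complex 1 (s + 1))" "0 \<le> t * cmod (Complex 1 (s + 2))"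
    using t by simp_all
  ultimately have "t * cmod (Complex 1 (s + 1)) \<le> r" "t * cmod (Complex 1 (s + 2)) \<le> r"
    using t by linarith+
  then have bw: "b \<in> cball a r" "w \<in> cball a r"
    using t by (simp_all add: b_def w_def dist_norm)
  have acb: "a \<in> cball a r" using r by simp
  have segb: "closed_segment a b - {a} \<subseteq> K"
  proof
    fix z assume z: "z \<in> closed_segment a b - {a}"
    then obtain u where u: "0 \<le> u" "z = (1 - u) *\<^sub>R a + u *\<^sub>R b"
      by (auto simp: in_segment)
    have "u \<noteq> 0" using z u by auto
    moreover have "Re (z - a) = u * t" "Im (z - a) = u * t * (s + 1)"
      by (simp_all add: u b_def algebra_simps)
    moreover have "z \<in> cball a r" using z closed_segment_subset[OF acb bw(1)] by auto
    ultimately show "z \<in> K" using u(1) t by (simp add: K_def algebra_simps)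
  qed
  have segw: "closed_segment a w - {a} \<subseteq> K"
  proof
    fix z assume z: "z \<in> closed_segment a w - {a}"
    then obtain u where u: "0 \<le> u" "z = (1 - u) *\<^sub>R a + u *\<^sub>R w"
      by (auto simp: in_segment)
    have "u \<noteq> 0" using z u by auto
    moreover have "Re (z - a) = u * t" "Im (z - a) = u * t * (s + 2)"
      by (simp_all add: u w_def algebra_simps)
    moreover have "z \<in> cball a r" using z closed_segment_subset[OF acb bw(2)] by auto
    ultimately show "z \<in> K" using u(1) t by (simp add: K_def algebra_simps)
  qed
  have segbw: "closed_segment b w \<subseteq> K"
  proof
    fix z assume z: "z \<in> closed_segment b w"
    then obtain u where u: "0 \<le> u" "z = (1 - u) *\<^sub>R b + u *\<^sub>R w"
      by (auto simp: in_segment)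
    moreover have "Re (z - a) = t" "Im (z - a) = s * t + t + u * t"
      by (simp_all add: u b_def w_def algebra_simps)
    moreover have "z \<in> cball a r" using z closed_segment_subset[OF bw] by auto
    ultimately show "z \<in> K" using u(1) t by (simp add: K_def add_pos_nonneg)
  qed
  have K: "K \<inter> p ` verts G = {}" "\<And>e. e \<in> edges G \<Longrightarrow> K \<inter> path_image (c e) = {}" "a \<notin> K"
    using free by (auto simp: K_def a_def)
  have bwK: "b \<in> K" "w \<in> K" using segbw by auto
  then have neq: "b \<noteq> a" "w \<noteq> a" "b \<noteq> w" using K(3) t by (auto simp: b_def w_def)
  have or: "orient a b w \<noteq> 0" "orient b a w \<noteq> 0" "orient w a b \<noteq> 0"
    using t by (simp_all add: orient_def b_def w_def algebra_simps)
  have I: "closed_segment a b \<inter> closed_segment a w \<subseteq> {a}"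
    "closed_segment a b \<inter> closed_segment b w \<subseteq> {b}"
    "closed_segment a w \<inter> closed_segment b w \<subseteq> {w}"
    using closed_segment_Int_common_end[OF or(1)] closed_segment_Int_common_end[OF or(2)]
      closed_segment_Int_common_end[OF or(3)] by (simp_all add: closed_segment_commute)
  \<comment> \<open>A set inside \<open>K\<close> apart from \<open>a\<close> can meet an old arc
    only in \<open>a\<close>, and only if \<open>v\<close> is an end of that edge.\<close>
  have meets: "T \<inter> path_image (c e) \<subseteq> p ` ({v} \<inter> e)" if "e \<in> edges G" "T - {a} \<subseteq> K" for e T
  proof
    fix z assume z: "z \<in> T \<inter> path_image (c e)"
    then have "z = a" using that K(2)[OF that(1)] by auto
    then have "p v \<in> p ` e" using z v D(4)[OF that(1)] by (auto simp: a_def)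
    then have "v \<in> e" using D(1) sub[OF that(1)] v by (auto simp: inj_on_def)
    then show "z \<in> p ` ({v} \<inter> e)" using \<open>z = a\<close> by (simp add: a_def)
  qed
  define P where "P = p(x := b, y := w)"
  have vxy: "v \<noteq> x" "v \<noteq> y" using v xy by auto
  have Pim: "P ` A = p ` A" if "A \<subseteq> verts G" for A
    using that xy by (auto simp: P_def)
  have Pv [simp]: "P v = a" "P x = b" "P y = w"
    using vxy xy(3) by (simp_all add: P_def a_def)
  have PV: "P ` ({x, y} \<union> verts G) = {b, w} \<union> p ` verts G"
    using Pim[of "verts G"] by (simp add: image_Un)
  have Pv2: "p ` ({v} \<inter> e) \<subseteq> P ` (insert v A \<inter> e)" for e A
    by (auto simp: a_def)
  have d1: "plane_drawing \<lparr>verts = insert x (verts G), edges = edges G\<rparr> (p(x := b)) c"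
  proof (rule plane_drawing_insert_vertex[OF d sub xy(1)])
    show "b \<notin> p ` verts G" using bwK(1) K(1) by blast
    show "b \<notin> path_image (c e)" if "e \<in> edges G" for e
      using bwK(1) K(2)[OF that] by blast
  qed
  have "p(x := b) ` insert x (verts G) = insert b (p ` verts G)"
    using xy(1) by auto
  then have "w \<notin> p(x := b) ` insert x (verts G)"
    using bwK K(1) neq by auto
  then have d2: "plane_drawing \<lparr>verts = {x, y} \<union> verts G, edges = edges G\<rparr> P c"
    using plane_drawing_insert_vertex[OF d1, of y w] xy sub bwK K(2)
    unfolding P_def by (simp add: insert_commute subset_insertI2 disjoint_iff)
  have new: "e \<notin> edges G" if "x \<in> e \<or> y \<in> e" for e
    using sub xy that by blast
  have Kseg: "T - {a} \<subseteq> K \<Longrightarrow> T \<inter> p ` verts G \<subseteq> {a}" for T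
    using K(1) by blast
  let ?V = "{x, y} \<union> verts G"
  have subV: "e \<subseteq> ?V" if "e \<in> edges G" for e
    using sub[OF that] by blast
  have "{v, x} \<noteq> {v, y}" "{v, x} \<noteq> {x, y}" "{v, y} \<noteq> {x, y}"
    using vxy xy(3) by (auto simp: doubleton_eq_iff)
  note new = this new
  have step: "T \<inter> path_image (c e) \<subseteq> P ` (insert v A \<inter> e)" if "e \<in> edges G" "T - {a} \<subseteq> K" for e T A
    using order_trans[OF meets[OF that] Pv2] .
  have bV: "a \<notin> closed_segment b w" "w \<notin> closed_segment a b" "b \<notin> closed_segment a w"
    using segbw K(3) I neq by auto
  have d3: "plane_drawing \<lparr>verts = ?V, edges = insert {v, x} (edges G)\<rparr> P (c({v, x} := linepath a b))"
    (is "plane_drawing _ P ?c1")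
  proof (rule plane_drawing_insert_edge[OF d2, simplified ugraph.simps], goal_cases)
    case 6
    show ?case unfolding PV using Kseg[OF segb] bV by auto
  next
    case (7 e)
    then show ?case using step[OF _ segb] by simp
  qed (use v subV new neq in simp_all)
  have d4: "plane_drawing \<lparr>verts = ?V, edges = insert {v, y} (insert {v, x} (edges G))\<rparr> P
      (?c1({v, y} := linepath a w))" (is "plane_drawing _ P ?c2")
  proof (rule plane_drawing_insert_edge[OF d3, simplified ugraph.simps], goal_cases)
    case (1 e)
    then show ?case using v subV by auto
  next
    case 6
    show ?case unfolding PV using Kseg[OF segw] bV by auto
  next
    case (7 e)
    then consider "e = {v, x}" | "e \<in> edges G" "e \<noteq> {v, x}" using new by blast
    then show ?case
    proof cases
      case 1
      then show ?thesis using I(1) by auto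
    next
      case 2
      then show ?thesis using step[OF _ segw] by simp
    qed
  qed (use v new neq in simp_all)
  have d5: "plane_drawing \<lparr>verts = ?V, edges = insert {x, y} (insert {v, y} (insert {v, x} (edges G)))\<rparr> P
      (?c2({x, y} := linepath b w))"
  proof (rule plane_drawing_insert_edge[OF d4, simplified ugraph.simps], goal_cases)
    case (1 e)
    then show ?case using v subV by auto
  next
    case 6
    show ?case unfolding PV using segbw K(1) by auto
  next
    case (7 e)
    then consider "e = {v, x}" | "e = {v, y}" | "e \<in> edges G" "e \<noteq> {v, x}" "e \<noteq> {v, y}" using new by blast
    then show ?case
    proof cases
      case 1
      then show ?thesis using I(2) new(1-3) by auto
    next
      case 2
      then show ?thesis using I(3) new(1-3) by auto
    next
      case 3
      then show ?thesis using segbw K(2) by auto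
    qed
  qed (use v new neq in simp_all)
  moreover have "insert {x, y} (insert {v, y} (insert {v, x} (edges G))) = {{v, x}, {v, y}, {x, y}} \<union> edges G"
    by blast
  ultimately show ?thesis by (auto simp: planar_def)
qed

section \<open>Straight-line drawings\<close>

definition list_graph :: "nat \<Rightarrow> (nat \<times> nat) list \<Rightarrow> nat ugraph" where
  "list_graph n es = \<lparr>verts = {..<n}, edges = (\<lambda>(i, j). {i, j}) ` set es\<rparr>"

text \<open>\<open>orient\<close> on integer points, so that a concrete drawing can be checked by
  evaluation.\<close>

definition orient_int :: "(int \<times> int) list \<Rightarrow> nat \<Rightarrow> nat \<Rightarrow> nat \<Rightarrow> int" where
  "orient_int P i j k =
     (fst (P ! j) - fst (P ! i)) * (snd (P ! k) - snd (P ! i)) -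
     (snd (P ! j) - snd (P ! i)) * (fst (P ! k) - fst (P ! i))"

text \<open>Edges with a common end need no separate clause: they meet only there because no third
  vertex is collinear with an edge.\<close>

definition straight_line_drawing :: "(int \<times> int) list \<Rightarrow> (nat \<times> nat) list \<Rightarrow> bool" where
  "straight_line_drawing P es \<longleftrightarrow> distinct P \<and> distinct es \<and>
     (\<forall>(i, j) \<in> set es. i < j \<and> j < length P \<and>
        (\<forall>k \<in> {0..<length P}. k = i \<or> k = j \<or> orient_int P i j k \<noteq> 0)) \<and>
     (\<forall>(i, j) \<in> set es. \<forall>(k, l) \<in> set es. k = i \<or> k = j \<or> l = i \<or> l = j \<or>
        orient_int P i j k * orient_int P i j l > 0 \<or>
        orient_int P k l i * orient_int P k l j > 0)"

lemma straight_line_drawing_list_graph: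
  assumes "straight_line_drawing P es"
  shows "simple_graph (list_graph (length P) es)" (is "simple_graph ?G")
    and "planar (list_graph (length P) es)"
    and "card (edges (list_graph (length P) es)) = length es"
proof -
  have dist: "distinct P" "distinct es"
    using assms by (simp_all add: straight_line_drawing_def)
  have A: "\<forall>(i, j) \<in> set es. i < j \<and> j < length P \<and>
        (\<forall>k \<in> {0..<length P}. k = i \<or> k = j \<or> orient_int P i j k \<noteq> 0)"
    and B: "\<forall>(i, j) \<in> set es. \<forall>(k, l) \<in> set es. k = i \<or> k = j \<or> l = i \<or> l = j \<or>
        orient_int P i j k * orient_int P i j l > 0 \<or> orient_int P k l i * orient_int P k l j > 0"
    using assms unfolding straight_line_drawing_def by iprover+
  have es: "i < j" "j < length P" "\<And>k. k < length P \<Longrightarrow> k = i \<or> k = j \<or> orient_int P i j k \<noteq> 0"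
    if "(i, j) \<in> set es" for i j
    using bspec[OF A that] by simp_all
  have pairs: "k = i \<or> k = j \<or> l = i \<or> l = j \<or> orient_int P i j k * orient_int P i j l > 0 \<or>
      orient_int P k l i * orient_int P k l j > 0" if "(i, j) \<in> set es" "(k, l) \<in> set es" for i j k l
    using bspec[OF bspec[OF B that(1), simplified] that(2)] by simp
  have edge: "\<exists>i j. e = {i, j} \<and> (i, j) \<in> set es" if "e \<in> edges ?G" for e
    using that by (auto simp: list_graph_def)
  show simple: "simple_graph ?G"
    unfolding simple_graph_def
  proof (intro conjI ballI)
    show "e \<subseteq> verts ?G" "card e = 2" if e: "e \<in> edges ?G" for e
    proof -
      obtain i j where "e = {i, j}" "(i, j) \<in> set es" using edge[OF e] by blast
      then show "e \<subseteq> verts ?G" "card e = 2"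
        using es(1,2)[of i j] by (auto simp: list_graph_def)
    qed
  qed (simp add: list_graph_def)
  have "inj_on (\<lambda>(i, j). {i, j}) (set es)"
    by (rule inj_onI) (auto simp: doubleton_eq_iff dest!: es(1))
  then show "card (edges ?G) = length es"
    using dist by (simp add: list_graph_def card_image distinct_card)
  define p where "p = (\<lambda>i. Complex (of_int (fst (P ! i))) (of_int (snd (P ! i))))"
  \<comment> \<open>Edges are listed as pairs \<open>i < j\<close>; \<open>Min\<close> and
    \<open>Max\<close> recover this order from the unordered edge.\<close>
  define c where "c = (\<lambda>e. linepath (p (Min e)) (p (Max e)))"
  have or: "orient (p i) (p j) (p k) = of_int (orient_int P i j k)" for i j k
    by (simp add: orient_def orient_int_def p_def)
  \<comment> \<open>With this sign rule, the noncollinearity recorded for \<open>i < j\<close> can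
    be used with either end in front.\<close>
  have or_rev: "orient_int P j i k = - orient_int P i j k" for i j k
    by (simp add: orient_int_def algebra_simps)
  have pinj: "p i = p j \<longleftrightarrow> i = j" if "i < length P" "j < length P" for i j
    using that dist(1) by (auto simp: p_def nth_eq_iff_index_eq prod_eq_iff[symmetric])
  have c: "c {i, j} = linepath (p i) (p j)" if "(i, j) \<in> set es" for i j
    using es(1)[OF that] by (simp add: c_def)
  have common: "closed_segment (p u) (p i) \<inter> closed_segment (p u) (p k) \<subseteq> {p u}"
    if "(u, i) \<in> set es \<or> (i, u) \<in> set es" "k < length P" "k \<noteq> u" "k \<noteq> i" for u i k
  proof (rule closed_segment_Int_common_end)
    show "orient (p u) (p i) (p k) \<noteq> 0"
      using that es(3)[of u i k] es(3)[of i u k] or_rev[of u i k] by (auto simp: or)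
  qed
  have "plane_drawing ?G p c"
  proof (rule plane_drawingI)
    show "inj_on p (verts ?G)"
      using pinj by (auto simp: inj_on_def list_graph_def)
    show "arc (c e)" if e: "e \<in> edges ?G" for e
    proof -
      obtain i j where "e = {i, j}" "(i, j) \<in> set es" using edge[OF e] by blast
      then show ?thesis using c es(1,2)[of i j] pinj[of i j] by auto
    qed
    show "{pathstart (c e), pathfinish (c e)} = p ` e" if "e \<in> edges ?G" for e
      using edge[OF that] c by auto
    show "e \<subseteq> verts ?G" if "e \<in> edges ?G" for e
      using simple that by (auto simp: simple_graph_def)
    show "path_image (c e) \<inter> p ` verts ?G \<subseteq> p ` e" if e: "e \<in> edges ?G" for e
    proof
      obtain i j where ij: "e = {i, j}" "(i, j) \<in> set es" using edge[OF e] by blast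
      fix z assume "z \<in> path_image (c e) \<inter> p ` verts ?G"
      then obtain k where k: "z = p k" "k < length P" "p k \<in> closed_segment (p i) (p j)"
        using c[OF ij(2)] ij(1) by (auto simp: list_graph_def)
      then have "orient_int P i j k = 0"
        using orient_closed_segment[OF k(3)] by (simp add: or)
      then show "z \<in> p ` e" using es(3)[OF ij(2) k(2)] k(1) ij(1) by blast
    qed
    show "path_image (c e) \<inter> path_image (c e') \<subseteq> p ` (e \<inter> e')"
      if e: "e \<in> edges ?G" "e' \<in> edges ?G" "e \<noteq> e'" for e e'
    proof -
      obtain i j where ij: "e = {i, j}" "(i, j) \<in> set es" using edge[OF e(1)] by blast
      obtain k l where kl: "e' = {k, l}" "(k, l) \<in> set es" using edge[OF e(2)] by blast
      note lt = es(1,2)[OF ij(2)] es(1,2)[OF kl(2)]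
      have im: "path_image (c e) = closed_segment (p i) (p j)" "path_image (c e') = closed_segment (p k) (p l)"
        using c[OF ij(2)] c[OF kl(2)] ij kl by simp_all
      consider "k = i" | "k = j" | "l = i" | "l = j" | "orient_int P i j k * orient_int P i j l > 0"
        | "orient_int P k l i * orient_int P k l j > 0"
        using pairs[OF ij(2) kl(2)] by blast
      then show ?thesis
      proof cases
        case 1
        then show ?thesis using common[of i j l] ij kl lt e(3) im by auto
      next
        case 2
        then show ?thesis using common[of j i l] ij kl lt e(3) im by (auto simp: closed_segment_commute)
      next
        case 3
        then show ?thesis using common[of i j k] ij kl lt e(3) im by (auto simp: closed_segment_commute)
      next
        case 4
        then show ?thesis using common[of j i k] ij kl lt e(3) im
          by (auto simp: closed_segment_commute insert_commute)
      next
        case 5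
        then have "closed_segment (p i) (p j) \<inter> closed_segment (p k) (p l) = {}"
          by (intro closed_segment_Int_same_side) (simp add: or flip: of_int_mult)
        then show ?thesis using im by simp
      next
        case 6
        then have "closed_segment (p k) (p l) \<inter> closed_segment (p i) (p j) = {}"
          by (intro closed_segment_Int_same_side) (simp add: or flip: of_int_mult)
        then show ?thesis using im by (simp add: Int_commute)
      qed
    qed
  qed
  then show "planar ?G" by (auto simp: planar_def)
qed

section \<open>4-cycles\<close>

lemma contains_C4_iff:
  assumes "simple_graph G"
  shows "contains_subgraph G C4 \<longleftrightarrow> (\<exists>a b c d. distinct [a, b, c, d] \<and>
    {a, b} \<in> edges G \<and> {b, c} \<in> edges G \<and> {c, d} \<in> edges G \<and> {d, a} \<in> edges G)"
    (is "_ \<longleftrightarrow> ?R")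
proof
  assume "contains_subgraph G C4"
  then obtain f :: "nat \<Rightarrow> 'a" where f: "inj_on f {0, 1, 2, 3}"
    "{f 0, f 1} \<in> edges G" "{f 1, f 2} \<in> edges G" "{f 2, f 3} \<in> edges G" "{f 3, f 0} \<in> edges G"
    unfolding contains_subgraph_def C4_def by auto
  moreover have "distinct [f 0, f 1, f 2, f 3]"
    using f(1) by (simp add: inj_on_def)
  ultimately show ?R by blast
next
  assume ?R
  then obtain a b c d where d: "distinct [a, b, c, d]" "{a, b} \<in> edges G" "{b, c} \<in> edges G"
    "{c, d} \<in> edges G" "{d, a} \<in> edges G" by blast
  then have "{a, b} \<subseteq> verts G" "{c, d} \<subseteq> verts G"
    using assms by (auto simp only: simple_graph_def)
  then show "contains_subgraph G C4"
    unfolding contains_subgraph_def C4_def using d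
    by (intro exI[of _ "\<lambda>i::nat. if i = 0 then a else if i = 1 then b else if i = 2 then c else d"])
      (auto simp: inj_on_def insert_commute)
qed

lemma contains_C4_plus_iff:
  assumes "simple_graph G"
  shows "contains_subgraph G C4_plus \<longleftrightarrow> (\<exists>a b c d x. distinct [a, b, c, d, x] \<and>
    {a, b} \<in> edges G \<and> {b, c} \<in> edges G \<and> {c, d} \<in> edges G \<and> {d, a} \<in> edges G \<and> {a, x} \<in> edges G)"
    (is "_ \<longleftrightarrow> ?R")
proof
  assume "contains_subgraph G C4_plus"
  then obtain f :: "nat \<Rightarrow> 'a" where f: "inj_on f {4, 0, 1, 2, 3}" "{f 0, f 4} \<in> edges G"
    "{f 0, f 1} \<in> edges G" "{f 1, f 2} \<in> edges G" "{f 2, f 3} \<in> edges G" "{f 3, f 0} \<in> edges G"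
    unfolding contains_subgraph_def C4_plus_def C4_def by auto
  moreover have "distinct [f 0, f 1, f 2, f 3, f 4]"
    using f(1) by (simp add: inj_on_def)
  ultimately show ?R by blast
next
  assume ?R
  then obtain a b c d x where d: "distinct [a, b, c, d, x]" "{a, b} \<in> edges G" "{b, c} \<in> edges G"
    "{c, d} \<in> edges G" "{d, a} \<in> edges G" "{a, x} \<in> edges G" by blast
  then have "{a, b} \<subseteq> verts G" "{c, d} \<subseteq> verts G" "{a, x} \<subseteq> verts G"
    using assms by (auto simp only: simple_graph_def)
  then show "contains_subgraph G C4_plus"
    unfolding contains_subgraph_def C4_plus_def C4_def using d
    by (intro exI[of _ "\<lambda>i::nat. if i = 0 then a else if i = 1 then b else if i = 2 then c
          else if i = 3 then d else x"])
      (auto simp: inj_on_def insert_commute)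
qed

section \<open>Attaching triangles and splitting off 4-cycles\<close>

lemma contains_subgraph_mono:
  assumes "contains_subgraph H F" "verts H \<subseteq> verts G" "edges H \<subseteq> edges G"
  shows "contains_subgraph G F"
  using assms unfolding contains_subgraph_def by blast

lemma contains_C4_plus_imp_C4: "contains_subgraph G C4_plus \<Longrightarrow> contains_subgraph G C4"
  unfolding contains_subgraph_def C4_plus_def by auto

text \<open>A cycle through \<open>x\<close> must pass through both of its neighbours
  \<open>v\<close> and \<open>y\<close>. The neighbours of \<open>y\<close> are \<open>x\<close> and
  \<open>v\<close>, so the cycle closes up as a triangle. The same holds for \<open>y\<close>, hence
  a 4-cycle would already be in \<open>G\<close>.\<close>

lemma C4_free_attach_triangle:
  assumes G: "simple_graph G" "\<not> contains_subgraph G C4" and v: "v \<in> verts G"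
    and xy: "x \<notin> verts G" "y \<notin> verts G" "x \<noteq> y"
  defines "H \<equiv> \<lparr>verts = {x, y} \<union> verts G, edges = {{v, x}, {v, y}, {x, y}} \<union> edges G\<rparr>"
  shows "simple_graph H" "\<not> contains_subgraph H C4" "card (verts H) = card (verts G) + 2"
    "card (edges H) = card (edges G) + 3"
proof -
  have sub: "e \<subseteq> verts G" if "e \<in> edges G" for e
    using G(1) that by (auto simp: simple_graph_def)
  have vxy: "v \<noteq> x" "v \<noteq> y" using v xy by auto
  show H: "simple_graph H"
    using G(1) v vxy xy by (auto simp: H_def simple_graph_def)
  have nx: "u = v \<or> u = y" if "{x, u} \<in> edges H \<or> {u, x} \<in> edges H" for u
    using that sub[of "{x, u}"] xy vxy by (auto simp: H_def doubleton_eq_iff insert_commute)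
  have ny: "u = v \<or> u = x" if "{y, u} \<in> edges H \<or> {u, y} \<in> edges H" for u
    using that sub[of "{y, u}"] xy vxy by (auto simp: H_def doubleton_eq_iff insert_commute)
  have old: "{u, w} \<in> edges G" if "{u, w} \<in> edges H" "u \<noteq> x" "u \<noteq> y" "w \<noteq> x" "w \<noteq> y" for u w
    using that by (auto simp: H_def doubleton_eq_iff)
  show "\<not> contains_subgraph H C4"
  proof
    assume "contains_subgraph H C4"
    then obtain a b c d where C: "distinct [a, b, c, d]" "{a, b} \<in> edges H" "{b, c} \<in> edges H"
      "{c, d} \<in> edges H" "{d, a} \<in> edges H"
      unfolding contains_C4_iff[OF H] by blast
    then have "a \<noteq> x" "b \<noteq> x" "c \<noteq> x" "d \<noteq> x" "a \<noteq> y" "b \<noteq> y" "c \<noteq> y" "d \<noteq> y"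
      using nx[of a] nx[of b] nx[of c] nx[of d] ny[of a] ny[of b] ny[of c] ny[of d] by auto
    then have "contains_subgraph G C4"
      unfolding contains_C4_iff[OF G(1)] using C old by blast
    then show False using G(2) by blast
  qed
  show "card (verts H) = card (verts G) + 2"
    using simple_graph_finite[OF G(1)] xy by (simp add: H_def)
  have "{v, x} \<notin> edges G" "{v, y} \<notin> edges G" "{x, y} \<notin> edges G"
    using sub xy by blast+
  moreover have "{v, x} \<noteq> {v, y}" "{v, x} \<noteq> {x, y}" "{v, y} \<noteq> {x, y}"
    using vxy xy(3) by (auto simp: doubleton_eq_iff)
  ultimately show "card (edges H) = card (edges G) + 3"
    using simple_graph_finite[OF G(1)] by (simp add: H_def)
qed

lemma planar_free_sizesI:
  fixes G :: "nat ugraph"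
  assumes "simple_graph G" "planar G" "\<not> contains_subgraph G H" "card (verts G) = n" "card (edges G) = m"
  shows "m \<in> planar_free_sizes n H"
  using assms by (auto simp: planar_free_sizes_def)

lemma planar_free_sizes_C4_add_triangle:
  assumes "m \<in> planar_free_sizes n C4" "n \<ge> 1"
  shows "m + 3 \<in> planar_free_sizes (n + 2) C4"
proof -
  obtain G :: "nat ugraph" where G: "simple_graph G" "planar G" "card (verts G) = n" "\<not> contains_subgraph G C4"
    "card (edges G) = m"
    using assms(1) by (auto simp: planar_free_sizes_def)
  obtain v where v: "v \<in> verts G" using G(3) assms(2) by fastforce
  obtain x where x: "x \<notin> verts G"
    using ex_new_if_finite[OF infinite_UNIV_nat simple_graph_finite(1)[OF G(1)]] by blast
  obtain y where y: "y \<notin> insert x (verts G)"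
    using ex_new_if_finite[OF infinite_UNIV_nat] simple_graph_finite(1)[OF G(1)] by (meson finite_insert)
  have xy: "x \<notin> verts G" "y \<notin> verts G" "x \<noteq> y" using x y by auto
  show ?thesis
    using planar_free_sizesI[OF C4_free_attach_triangle(1)[OF G(1,4) v xy] planar_attach_triangle[OF G(2,1) v xy]
        C4_free_attach_triangle(2)[OF G(1,4) v xy] C4_free_attach_triangle(3)[OF G(1,4) v xy]
        C4_free_attach_triangle(4)[OF G(1,4) v xy]] G(3,5) by simp
qed

text \<open>The replacement for a 4-cycle component: as many new vertices as it has, and as many new
  edges as it can have.\<close>

lemma planar_free_sizes_C4_add_bowtie:
  assumes "m \<in> planar_free_sizes n C4" "n \<ge> 1"
  shows "m + 6 \<in> planar_free_sizes (n + 4) C4"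
proof -
  have "m + 3 + 3 \<in> planar_free_sizes (n + 2 + 2) C4"
    using planar_free_sizes_C4_add_triangle assms by (metis trans_le_add1)
  moreover have "m + 3 + 3 = m + 6" "n + 2 + 2 = n + 4" by simp_all
  ultimately show ?thesis by (simp only:)
qed

text \<open>After a rotation, any vertex of the 4-cycle can play the role of \<open>a\<close>; an
  edge from it to a vertex outside \<open>W\<close> would be the pendant edge.\<close>

lemma C4_plus_free_split:
  assumes G: "simple_graph G" "\<not> contains_subgraph G C4_plus" "contains_subgraph G C4"
  obtains W where "W \<subseteq> verts G" "card W = 4" "\<And>e. e \<in> edges G \<Longrightarrow> e \<subseteq> W \<or> e \<inter> W = {}"
proof -
  obtain a b c d where C: "distinct [a, b, c, d]" "{a, b} \<in> edges G" "{b, c} \<in> edges G"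
    "{c, d} \<in> edges G" "{d, a} \<in> edges G"
    using G(3) unfolding contains_C4_iff[OF G(1)] by blast
  define W where "W = {a, b, c, d}"
  have "{a, b} \<subseteq> verts G" "{c, d} \<subseteq> verts G"
    using C G(1) by (auto simp only: simple_graph_def)
  then have "W \<subseteq> verts G" by (simp add: W_def)
  moreover have "card W = 4" using C(1) by (simp add: W_def)
  moreover have "e \<subseteq> W \<or> e \<inter> W = {}" if e: "e \<in> edges G" for e
  proof (rule ccontr)
    assume *: "\<not> ?thesis"
    have "card e = 2" using e G(1) by (simp add: simple_graph_def)
    then obtain u x where ux: "e = {u, x}" "u \<in> W" "x \<notin> W"
      using * by (auto simp: card_2_iff insert_commute)
    have no: False if "distinct [a, b, c, d, x]" "{a, b} \<in> edges G" "{b, c} \<in> edges G"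
      "{c, d} \<in> edges G" "{d, a} \<in> edges G" "{a, x} \<in> edges G" for a b c d
      using G(2) that unfolding contains_C4_plus_iff[OF G(1)] by blast
    consider "u = a" | "u = b" | "u = c" | "u = d" using ux(2) by (auto simp: W_def)
    then show False
    proof cases
      case 1
      then show ?thesis using no[of a b c d] C ux e by (simp add: W_def eq_commute)
    next
      case 2
      then show ?thesis using no[of b c d a] C ux e by (simp add: W_def eq_commute)
    next
      case 3
      then show ?thesis using no[of c d a b] C ux e by (simp add: W_def eq_commute)
    next
      case 4
      then show ?thesis using no[of d a b c] C ux e by (simp add: W_def eq_commute)
    qed
  qed
  ultimately show ?thesis by (rule that)
qed

lemma card_edges_le_choose:
  assumes "finite W" "\<And>e. e \<in> F \<Longrightarrow> e \<subseteq> W \<and> card e = 2"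
  shows "card F \<le> card W choose 2"
proof -
  have "card F \<le> card {e. e \<subseteq> W \<and> card e = 2}"
    using assms by (intro card_mono) auto
  then show ?thesis using n_subsets[OF assms(1)] by simp
qed

lemma four_choose_two: "(4::nat) choose 2 = 6"
  by (simp add: numeral_eq_Suc)

text \<open>The trivial bound. It is applied to the four vertices that remain when a 4-cycle
  component is removed from 8.\<close>

lemma planar_free_sizes_le_choose: "m \<in> planar_free_sizes n H \<Longrightarrow> m \<le> n choose 2"
  unfolding planar_free_sizes_def simple_graph_def by (auto intro!: card_edges_le_choose)

lemma planar_free_sizes_C4_subset: "planar_free_sizes n C4 \<subseteq> planar_free_sizes n C4_plus"
  unfolding planar_free_sizes_def using contains_C4_plus_imp_C4 by blast

text \<open>The descent step. If there is a 4-cycle, deleting its vertex set loses only the at most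
  6 edges inside it, and the remainder is a subgraph, hence still planar and without
  \<open>C4_plus\<close>.\<close>

lemma planar_free_sizes_C4_plus_cases:
  assumes "m \<in> planar_free_sizes n C4_plus"
  obtains "m \<in> planar_free_sizes n C4"
  | k where "n \<ge> 4" "k \<in> planar_free_sizes (n - 4) C4_plus" "m \<le> k + 6"
proof -
  obtain G :: "nat ugraph" where G: "simple_graph G" "planar G" "card (verts G) = n"
    "\<not> contains_subgraph G C4_plus" "card (edges G) = m"
    using assms by (auto simp: planar_free_sizes_def)
  show ?thesis
  proof (cases "contains_subgraph G C4")
    case False
    then show ?thesis using planar_free_sizesI[OF G(1,2) False G(3,5)] that(1) by blast
  next
    case True
    obtain W where W: "W \<subseteq> verts G" "card W = 4" "\<And>e. e \<in> edges G \<Longrightarrow> e \<subseteq> W \<or> e \<inter> W = {}"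
      using C4_plus_free_split[OF G(1,4) True] by blast
    define H where "H = \<lparr>verts = verts G - W, edges = {e \<in> edges G. e \<inter> W = {}}\<rparr>"
    have fin: "finite (verts G)" "finite (edges G)" using simple_graph_finite[OF G(1)] by auto
    have "card W \<le> n" using W(1) G(3) card_mono[OF fin(1)] by blast
    have H: "simple_graph H"
      using G(1) by (auto simp: H_def simple_graph_def)
    have sub: "verts H \<subseteq> verts G" "edges H \<subseteq> edges G" by (auto simp: H_def)
    have "card (verts H) = n - 4"
      using W G(3) fin by (simp add: H_def card_Diff_subset finite_subset)
    then have "card (edges H) \<in> planar_free_sizes (n - 4) C4_plus"
      using planar_free_sizesI[OF H planar_subgraph[OF G(2) sub H]] contains_subgraph_mono[OF _ sub] G(4) by blast
    moreover have "card {e \<in> edges G. e \<subseteq> W} \<le> card W choose 2"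
      using G(1) W(1) fin by (intro card_edges_le_choose) (auto simp: simple_graph_def finite_subset)
    moreover have "edges G \<subseteq> edges H \<union> {e \<in> edges G. e \<subseteq> W}"
      using W(3) by (auto simp: H_def)
    then have "m \<le> card (edges H \<union> {e \<in> edges G. e \<subseteq> W})"
      unfolding G(5)[symmetric] using fin sub by (intro card_mono) (auto intro: finite_subset)
    ultimately show ?thesis
      using that(2)[of "card (edges H)"] W(2) four_choose_two \<open>card W \<le> n\<close> card_Un_le[of "edges H" "{e \<in> edges G. e \<subseteq> W}"]
      by simp
  qed
qed

section \<open>Three explicit graphs\<close>

text \<open>An executable test on walks a, b, c, d, with each edge available in both directions.
  Only opposite vertices are compared, since consecutive ones differ in a graph without
  loops.\<close>

definition no_C4 :: "(nat \<times> nat) list \<Rightarrow> bool" where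
  "no_C4 es \<longleftrightarrow> (let es' = es @ map prod.swap es in
     \<forall>(a, b) \<in> set es'. \<forall>(b', c) \<in> set es'. b = b' \<and> a \<noteq> c \<longrightarrow>
       (\<forall>(c', d) \<in> set es'. c = c' \<and> d \<noteq> b \<longrightarrow> (d, a) \<notin> set es'))"

lemma no_C4_list_graph:
  assumes "no_C4 es" "simple_graph (list_graph n es)"
  shows "\<not> contains_subgraph (list_graph n es) C4"
proof
  define E where "E = set (es @ map prod.swap es)"
  have E: "(i, j) \<in> E" if "{i, j} \<in> edges (list_graph n es)" for i j
    using that by (force simp: E_def list_graph_def doubleton_eq_iff)
  assume "contains_subgraph (list_graph n es) C4"
  then obtain a b c d where "distinct [a, b, c, d]" "(a, b) \<in> E" "(b, c) \<in> E" "(c, d) \<in> E" "(d, a) \<in> E"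
    unfolding contains_C4_iff[OF assms(2)] using E by meson
  then show False
    using assms(1) unfolding no_C4_def Let_def E_def[symmetric] by fastforce
qed

lemma card_verts_list_graph: "card (verts (list_graph n es)) = n"
  by (simp add: list_graph_def)

lemma drawing_planar_free_size:
  assumes "straight_line_drawing P es" "\<not> contains_subgraph (list_graph (length P) es) H"
  shows "length es \<in> planar_free_sizes (length P) H"
  using straight_line_drawing_list_graph[OF assms(1)] assms(2) card_verts_list_graph
  by (intro planar_free_sizesI)

text \<open>The coordinates and the graph with 11 edges come from a computer search.\<close>

definition drawing8 :: "(int \<times> int) list" where
  "drawing8 = [(1, 0), (3, 4), (1, 2), (2, 0), (3, 5), (5, 5), (0, 3), (4, 1)]"

text \<open>Three triangles {0, 2, 6}, {1, 4, 6}, {3, 5, 7}, the first two sharing the vertex 6, and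
  the edges {1, 5} and {2, 3}.\<close>

definition graph8 :: "(nat \<times> nat) list" where
  "graph8 = [(0, 2), (0, 6), (1, 4), (1, 5), (1, 6), (2, 3), (2, 6), (3, 5), (3, 7), (4, 6), (5, 7)]"

definition drawing_2K4 :: "(int \<times> int) list" where
  "drawing_2K4 = [(4, 0), (3, 2), (4, 1), (6, 2), (6, 5), (0, 0), (5, 5), (0, 6)]"

definition graph_2K4 :: "(nat \<times> nat) list" where
  "graph_2K4 = [(0, 1), (0, 2), (0, 3), (1, 2), (1, 3), (2, 3),
     (4, 5), (4, 6), (4, 7), (5, 6), (5, 7), (6, 7)]"

definition drawing12 :: "(int \<times> int) list" where
  "drawing12 = [(6, 0), (4, 2), (1, 0), (6, 2), (5, 4), (5, 6), (1, 1), (2, 2), (4, 5), (0, 5), (2, 6), (1, 3)]"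

text \<open>K4 with every vertex replaced by a triangle; the last six pairs are the edges of that
  K4. Two triangles are joined by a single edge, so no 4-cycle arises.\<close>

definition truncated_tetrahedron :: "(nat \<times> nat) list" where
  "truncated_tetrahedron = [(0, 1), (0, 2), (1, 2), (3, 4), (3, 5), (4, 5), (6, 7), (6, 8), (7, 8),
     (9, 10), (9, 11), (10, 11), (0, 3), (1, 6), (2, 9), (4, 7), (5, 10), (8, 11)]"

lemma straight_line_drawing8: "straight_line_drawing drawing8 graph8"
  by code_simp

lemma straight_line_drawing_2K4: "straight_line_drawing drawing_2K4 graph_2K4"
  by code_simp

lemma straight_line_drawing12: "straight_line_drawing drawing12 truncated_tetrahedron"
  by code_simp

lemma no_C4_graph8: "no_C4 graph8"
  by code_simp

lemma no_C4_truncated_tetrahedron: "no_C4 truncated_tetrahedron"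
  by code_simp

lemma size8_C4: "11 \<in> planar_free_sizes 8 C4"
proof -
  have "length drawing8 = 8" "length graph8 = 11" by (simp_all add: drawing8_def graph8_def)
  then show ?thesis
    using drawing_planar_free_size[OF straight_line_drawing8]
      no_C4_list_graph[OF no_C4_graph8 straight_line_drawing_list_graph(1)[OF straight_line_drawing8]]
    by (simp only:) blast
qed

lemma size12_C4: "18 \<in> planar_free_sizes 12 C4"
proof -
  have "length drawing12 = 12" "length truncated_tetrahedron = 18"
    by (simp_all add: drawing12_def truncated_tetrahedron_def)
  then show ?thesis
    using drawing_planar_free_size[OF straight_line_drawing12]
      no_C4_list_graph[OF no_C4_truncated_tetrahedron straight_line_drawing_list_graph(1)[OF straight_line_drawing12]]
    by (simp only:) blast
qed

text \<open>\<open>C4_plus\<close> is connected and has five vertices, while an edge of 2K4 stays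
  within one of two blocks of four.\<close>

lemma size8_C4_plus: "12 \<in> planar_free_sizes 8 C4_plus"
proof -
  let ?G = "list_graph (length drawing_2K4) graph_2K4"
  note d = straight_line_drawing_list_graph[OF straight_line_drawing_2K4]
  have edge: "i < 8 \<and> j < 8 \<and> (i < 4 \<longleftrightarrow> j < 4)" if "{i, j} \<in> edges ?G" for i j
    using that by (auto simp: list_graph_def graph_2K4_def doubleton_eq_iff)
  have "\<not> contains_subgraph ?G C4_plus"
  proof
    assume "contains_subgraph ?G C4_plus"
    then obtain a b c e x where *: "distinct [a, b, c, e, x]" "{a, b} \<in> edges ?G" "{b, c} \<in> edges ?G"
      "{c, e} \<in> edges ?G" "{a, x} \<in> edges ?G"
      unfolding contains_C4_plus_iff[OF d(1)] by blast
    then have "{a, b, c, e, x} \<subseteq> {..<4} \<or> {a, b, c, e, x} \<subseteq> {4..<8}"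
      using edge[OF *(2)] edge[OF *(3)] edge[OF *(4)] edge[OF *(5)] by (cases "a < 4") auto
    then have "card {a, b, c, e, x} \<le> 4"
      using card_mono[of "{..<4::nat}"] card_mono[of "{4..<8::nat}"] by fastforce
    then show False using *(1) by simp
  qed
  moreover have "length drawing_2K4 = 8" "length graph_2K4 = 12"
    by (simp_all add: drawing_2K4_def graph_2K4_def)
  ultimately show ?thesis
    using drawing_planar_free_size[OF straight_line_drawing_2K4] by (simp only:) blast
qed

section \<open>C4-free graphs on 8 vertices\<close>

definition nbrs :: "'a ugraph \<Rightarrow> 'a \<Rightarrow> 'a set" where
  "nbrs G v = {u. {v, u} \<in> edges G}"

lemma nbrs_sym: "u \<in> nbrs G v \<longleftrightarrow> v \<in> nbrs G u"
  by (simp add: nbrs_def insert_commute)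

lemma nbrs_subset:
  assumes "simple_graph G"
  shows "nbrs G v \<subseteq> verts G - {v}"
proof
  fix u assume "u \<in> nbrs G v"
  then have "{v, u} \<subseteq> verts G" "card {v, u} = 2"
    using assms by (auto simp only: simple_graph_def nbrs_def mem_Collect_eq)
  then show "u \<in> verts G - {v}" by auto
qed

text \<open>The handshake lemma, by double counting of incidences.\<close>

lemma sum_card_nbrs:
  assumes "simple_graph G"
  shows "(\<Sum>v\<in>verts G. card (nbrs G v)) = 2 * card (edges G)"
proof -
  have E: "e \<subseteq> verts G" "card e = 2" if "e \<in> edges G" for e
    using assms that by (auto simp: simple_graph_def)
  have "card (nbrs G v) = card {e \<in> edges G. v \<in> e}" if "v \<in> verts G" for v
  proof (rule bij_betw_same_card)
    have "e \<in> (\<lambda>u. {v, u}) ` nbrs G v" if e: "e \<in> edges G" "v \<in> e" for e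
    proof -
      obtain u where "e = {v, u}"
        using E(2)[OF e(1)] e(2) by (auto simp: card_2_iff)
      then show ?thesis using e by (auto simp: nbrs_def)
    qed
    then show "bij_betw (\<lambda>u. {v, u}) (nbrs G v) {e \<in> edges G. v \<in> e}"
      by (auto simp: bij_betw_def inj_on_def doubleton_eq_iff nbrs_def)
  qed
  then have "(\<Sum>v\<in>verts G. card (nbrs G v)) = (\<Sum>v\<in>verts G. card {e \<in> edges G. v \<in> e})"
    by simp
  also have "\<dots> = 2 * card (edges G)"
  proof (rule sum_multicount)
    show "\<forall>e\<in>edges G. card {v \<in> verts G. v \<in> e} = 2"
    proof
      fix e assume "e \<in> edges G"
      then have "{v \<in> verts G. v \<in> e} = e" using E(1) by blast
      then show "card {v \<in> verts G. v \<in> e} = 2" using E(2) \<open>e \<in> edges G\<close> by simp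
    qed
  qed (use simple_graph_finite[OF assms] in auto)
  finally show ?thesis .
qed

text \<open>One term below \<open>c\<close> would push the sum below its lower bound. This turns a
  tight count into exact local information.\<close>

lemma sum_nat_le_eq:
  fixes f :: "'a \<Rightarrow> nat"
  assumes "finite S" "\<And>x. x \<in> S \<Longrightarrow> f x \<le> c" "card S * c \<le> sum f S" "x \<in> S"
  shows "f x = c"
proof (rule ccontr)
  assume "f x \<noteq> c"
  then have "f x < c" using assms(2,4) le_neq_implies_less by blast
  then have "sum f S < (\<Sum>x\<in>S. c)"
    using assms(1,2,4) by (intro sum_strict_mono_ex1) auto
  then show False using assms(3) by simp
qed

text \<open>Otherwise u, a, w, b is a 4-cycle. All later arguments use C4-freeness in this
  form.\<close>

lemma C4_free_common_nbrs:
  assumes "simple_graph G" "\<not> contains_subgraph G C4" "u \<noteq> w"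
    "a \<in> nbrs G u \<inter> nbrs G w" "b \<in> nbrs G u \<inter> nbrs G w"
  shows "a = b"
proof (rule ccontr)
  assume "a \<noteq> b"
  have "a \<noteq> u" "a \<noteq> w" "b \<noteq> u" "b \<noteq> w"
    using assms(4,5) nbrs_subset[OF assms(1)] by blast+
  moreover have "{u, a} \<in> edges G" "{a, w} \<in> edges G" "{w, b} \<in> edges G" "{b, u} \<in> edges G"
    using assms(4,5) by (auto simp: nbrs_def insert_commute)
  ultimately show False
    using assms(2,3) \<open>a \<noteq> b\<close> unfolding contains_C4_iff[OF assms(1)]
    by (metis distinct_length_2_or_more distinct_singleton)
qed

text \<open>The degree sum is split over v, its neighbourhood and the rest R; the edges between the
  neighbourhood and R are counted from the side of R.\<close>

lemma C4_free_nbrs_count: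
  assumes G: "simple_graph G" "\<not> contains_subgraph G C4" and v: "v \<in> verts G"
  defines "R \<equiv> verts G - insert v (nbrs G v)"
  shows "card R + card (nbrs G v) + 1 = card (verts G)"
    and "u \<noteq> v \<Longrightarrow> card (nbrs G u \<inter> nbrs G v) \<le> 1"
    and "w \<in> R \<Longrightarrow> card (nbrs G w \<inter> R) \<le> card R - 1"
    and "(\<Sum>u\<in>nbrs G v. card (nbrs G u)) =
      card (nbrs G v) + (\<Sum>u\<in>nbrs G v. card (nbrs G u \<inter> nbrs G v)) + (\<Sum>w\<in>R. card (nbrs G w \<inter> nbrs G v))"
    and "2 * card (edges G) = 2 * card (nbrs G v) + (\<Sum>u\<in>nbrs G v. card (nbrs G u \<inter> nbrs G v)) +
      2 * (\<Sum>w\<in>R. card (nbrs G w \<inter> nbrs G v)) + (\<Sum>w\<in>R. card (nbrs G w \<inter> R))"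
proof -
  define A where "A = nbrs G v"
  have fin: "finite (verts G)" using simple_graph_finite[OF G(1)] by simp
  have sub: "nbrs G u \<subseteq> verts G - {u}" for u by (rule nbrs_subset[OF G(1)])
  have finN: "finite (nbrs G u)" for u using sub[of u] fin by (meson finite_Diff finite_subset)
  have finR: "finite R" using fin by (simp add: R_def)
  have V: "verts G = insert v (A \<union> R)" "v \<notin> A \<union> R" "A \<inter> R = {}"
    using v sub[of v] by (auto simp: R_def A_def)
  show "card R + card (nbrs G v) + 1 = card (verts G)"
    using V finN[of v] finR by (simp add: card_Un_disjoint flip: A_def)
  show "card (nbrs G u \<inter> nbrs G v) \<le> 1" if "u \<noteq> v" for u
    using C4_free_common_nbrs[OF G that] finN by (simp add: card_le_Suc0_iff_eq)
  show "card (nbrs G w \<inter> R) \<le> card R - 1" if w: "w \<in> R" for w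
  proof -
    have "card (nbrs G w \<inter> R) \<le> card (R - {w})"
      using finR sub[of w] by (intro card_mono) auto
    then show ?thesis using w by simp
  qed
  have degA: "card (nbrs G u) = 1 + card (nbrs G u \<inter> A) + card (nbrs G u \<inter> R)" if u: "u \<in> A" for u
  proof -
    have "v \<in> nbrs G u" using u nbrs_sym unfolding A_def by fast
    then have "nbrs G u = insert v ((nbrs G u \<inter> A) \<union> (nbrs G u \<inter> R))"
      using V(1) sub[of u] by blast
    also have "card \<dots> = 1 + card ((nbrs G u \<inter> A) \<union> (nbrs G u \<inter> R))"
      using V(2) finN[of u] by (subst card_insert_disjoint) auto
    also have "card ((nbrs G u \<inter> A) \<union> (nbrs G u \<inter> R)) = card (nbrs G u \<inter> A) + card (nbrs G u \<inter> R)"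
      using V(3) finN[of u] by (intro card_Un_disjoint) auto
    finally show ?thesis by simp
  qed
  have degR: "card (nbrs G w) = card (nbrs G w \<inter> A) + card (nbrs G w \<inter> R)" if w: "w \<in> R" for w
  proof -
    have "w \<notin> nbrs G v" "w \<noteq> v" using w by (auto simp: R_def)
    then have "v \<notin> nbrs G w" using nbrs_sym by fast
    then have "nbrs G w = (nbrs G w \<inter> A) \<union> (nbrs G w \<inter> R)"
      using V(1) sub[of w] by auto
    then have "card (nbrs G w) = card ((nbrs G w \<inter> A) \<union> (nbrs G w \<inter> R))" by simp
    also have "\<dots> = card (nbrs G w \<inter> A) + card (nbrs G w \<inter> R)"
      using V(3) finN[of w] by (intro card_Un_disjoint) auto
    finally show ?thesis .
  qed
  have "(\<Sum>u\<in>A. card {w \<in> R. w \<in> nbrs G u}) = (\<Sum>w\<in>R. card (nbrs G w \<inter> A))"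
  proof (rule sum_multicount_gen)
    show "\<forall>w\<in>R. card {u \<in> A. w \<in> nbrs G u} = card (nbrs G w \<inter> A)"
      by (auto intro!: arg_cong[of _ _ card] simp: nbrs_sym[of _ G])
    show "finite A" using finN by (simp add: A_def)
  qed (rule finR)
  moreover have "{w \<in> R. w \<in> nbrs G u} = nbrs G u \<inter> R" for u by blast
  ultimately have cross: "(\<Sum>u\<in>A. card (nbrs G u \<inter> R)) = (\<Sum>w\<in>R. card (nbrs G w \<inter> A))" by simp
  have sumA: "(\<Sum>u\<in>A. card (nbrs G u)) = card A + (\<Sum>u\<in>A. card (nbrs G u \<inter> A)) + (\<Sum>w\<in>R. card (nbrs G w \<inter> A))"
  proof -
    have "(\<Sum>u\<in>A. card (nbrs G u)) = (\<Sum>u\<in>A. 1 + card (nbrs G u \<inter> A) + card (nbrs G u \<inter> R))"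
      using degA by (rule sum.cong[OF refl])
    then show ?thesis unfolding sum.distrib cross by simp
  qed
  then show "(\<Sum>u\<in>nbrs G v. card (nbrs G u)) =
      card (nbrs G v) + (\<Sum>u\<in>nbrs G v. card (nbrs G u \<inter> nbrs G v)) + (\<Sum>w\<in>R. card (nbrs G w \<inter> nbrs G v))"
    by (simp only: A_def)
  have "(\<Sum>u\<in>verts G. card (nbrs G u)) = card A + (\<Sum>u\<in>A. card (nbrs G u)) + (\<Sum>w\<in>R. card (nbrs G w))"
    unfolding V(1) using V(2,3) finN[of v] finR
    by (simp add: sum.union_disjoint A_def)
  moreover have "(\<Sum>w\<in>R. card (nbrs G w)) = (\<Sum>w\<in>R. card (nbrs G w \<inter> A)) + (\<Sum>w\<in>R. card (nbrs G w \<inter> R))"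
    using degR by (simp add: sum.distrib)
  ultimately show "2 * card (edges G) = 2 * card (nbrs G v) + (\<Sum>u\<in>nbrs G v. card (nbrs G u \<inter> nbrs G v)) +
      2 * (\<Sum>w\<in>R. card (nbrs G w \<inter> nbrs G v)) + (\<Sum>w\<in>R. card (nbrs G w \<inter> R))"
    using sumA sum_card_nbrs[OF G(1)] by (simp add: A_def)
qed

text \<open>With 12 edges the count is tight and forces degree 4: \<open>A\<close> induces a perfect
  matching, \<open>R\<close> is a triangle, and each vertex of \<open>R\<close> has one neighbour in
  \<open>A\<close>. These three neighbours are distinct and pairwise nonadjacent, so the matching
  would have to pair all of them with the one remaining vertex of \<open>A\<close>.\<close>

lemma C4_free_8_degree_ge_4:
  assumes G: "simple_graph G" "\<not> contains_subgraph G C4" and n: "card (verts G) = 8"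
    and v: "v \<in> verts G" "card (nbrs G v) \<ge> 4"
  shows "card (edges G) \<le> 11"
proof (rule ccontr)
  assume "\<not> ?thesis"
  then have big: "24 \<le> 2 * card (edges G)" by simp
  define A where "A = nbrs G v"
  define R where "R = verts G - insert v A"
  note count = C4_free_nbrs_count[OF G v(1), folded A_def, folded R_def, unfolded n]
  have fin: "finite A" "finite R"
    using simple_graph_finite(1)[OF G(1)] nbrs_subset[OF G(1), of v]
    by (auto simp: A_def R_def finite_subset)
  have vA: "v \<notin> A" "v \<notin> R" "A \<inter> R = {}"
    using nbrs_subset[OF G(1), of v] by (auto simp: A_def R_def)
  have a: "card (nbrs G u \<inter> A) \<le> 1" if "u \<in> A \<union> R" for u
    using count(2)[of u] that vA by blast
  have sA: "(\<Sum>u\<in>A. card (nbrs G u \<inter> A)) \<le> card A"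
    using sum_bounded_above[of A "\<lambda>u. card (nbrs G u \<inter> A)" 1] a by simp
  have sR: "(\<Sum>w\<in>R. card (nbrs G w \<inter> A)) \<le> card R"
    using sum_bounded_above[of R "\<lambda>u. card (nbrs G u \<inter> A)" 1] a by simp
  have sR2: "(\<Sum>w\<in>R. card (nbrs G w \<inter> R)) \<le> card R * (card R - 1)"
    using sum_bounded_above[of R "\<lambda>u. card (nbrs G u \<inter> R)" "card R - 1"] count(3) by simp
  have cR: "card R = 7 - card A" "card A \<le> 7" using count(1) by simp_all
  consider "card A = 4" | "card A = 5" | "card A = 6" | "card A = 7"
    using cR v(2) unfolding A_def by linarith
  \<comment> \<open>For \<open>card A\<close> = 4, 5, 6, 7 the bounds give a degree sum of at most
    24, 21, 20, 21, so only 4 is compatible with 24.\<close>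
  then have A4: "card A = 4"
    using count(5) sA sR sR2 cR(1) big by cases simp_all
  then have R3: "card R = 3" using cR by simp
  have "card A * 1 \<le> (\<Sum>u\<in>A. card (nbrs G u \<inter> A))"
       "card R * 1 \<le> (\<Sum>w\<in>R. card (nbrs G w \<inter> A))"
       "card R * 2 \<le> (\<Sum>w\<in>R. card (nbrs G w \<inter> R))"
    using count(5) sA sR sR2 A4 R3 big by simp_all
  then have eqA: "card (nbrs G u \<inter> A) = 1" if "u \<in> A \<union> R" for u
    using sum_nat_le_eq[of A "\<lambda>u. card (nbrs G u \<inter> A)" 1 u]
      sum_nat_le_eq[of R "\<lambda>u. card (nbrs G u \<inter> A)" 1 u] a fin that by auto
  have eqR: "card (nbrs G w \<inter> R) = 2" if "w \<in> R" for w
    using sum_nat_le_eq[of R "\<lambda>u. card (nbrs G u \<inter> R)" 2 w] fin that count(3) R3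
      \<open>card R * 2 \<le> _\<close> by simp
  have adjR: "w' \<in> nbrs G w" if "w \<in> R" "w' \<in> R" "w \<noteq> w'" for w w'
  proof -
    have "nbrs G w \<inter> R \<subseteq> R - {w}" using nbrs_subset[OF G(1), of w] by blast
    moreover have "card (R - {w}) = 2" using that R3 by simp
    ultimately have "nbrs G w \<inter> R = R - {w}"
      using eqR[OF that(1)] fin by (intro card_subset_eq) auto
    then show ?thesis using that by blast
  qed
  obtain a b c where R: "R = {a, b, c}" "a \<noteq> b" "a \<noteq> c" "b \<noteq> c"
    using R3 by (auto simp: card_3_iff)
  \<comment> \<open>On \<open>R\<close> this is the only neighbour in \<open>A\<close>; on
    \<open>A\<close> it is the partner in the matching.\<close>
  define f where "f = (\<lambda>w. SOME u. u \<in> nbrs G w \<inter> A)"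
  have f: "f w \<in> nbrs G w" "f w \<in> A" if "w \<in> A \<union> R" for w
  proof -
    have "nbrs G w \<inter> A \<noteq> {}" using eqA[OF that] by auto
    then have "f w \<in> nbrs G w \<inter> A" unfolding f_def by (rule some_in_eq[THEN iffD2])
    then show "f w \<in> nbrs G w" "f w \<in> A" by auto
  qed
  have f_inj: "f w \<noteq> f w'" if w: "w \<in> R" "w' \<in> R" "w \<noteq> w'" for w w'
  proof
    assume eq: "f w = f w'"
    obtain x where x: "x \<in> R" "x \<noteq> w" "x \<noteq> w'"
      using R w by blast
    \<comment> \<open>The third vertex \<open>x\<close> of the triangle \<open>R\<close> is also a
      common neighbour of \<open>w\<close> and \<open>w'\<close>.\<close>
    have "f w = x"
      using C4_free_common_nbrs[OF G w(3), of "f w" x] f[of w] f[of w'] w adjR x eq by auto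
    then show False using f(2)[of w] w x vA by auto
  qed
  have f_nonadj: "f w' \<notin> nbrs G (f w)" if w: "w \<in> R" "w' \<in> R" "w \<noteq> w'" for w w'
  proof
    assume "f w' \<in> nbrs G (f w)"
    then have "f w \<in> nbrs G (f w')" using nbrs_sym by fast
    moreover have "w \<noteq> f w'" using f(2)[of w'] w vA by auto
    moreover have "w' \<in> nbrs G (f w')" using f(1)[of w'] w nbrs_sym by fast
    \<comment> \<open>Otherwise w, f w, f w', w' would be a 4-cycle.\<close>
    ultimately have "f w = w'"
      using C4_free_common_nbrs[OF G, of w "f w'" "f w" w'] f(1)[of w] adjR w by auto
    then show False using f(2)[of w] w vA by auto
  qed
  have "card (f ` R) = 3"
    using f_inj R3 by (subst card_image) (auto simp: inj_on_def)
  moreover have "f ` R \<subseteq> A" using f by auto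
  ultimately have "card (A - f ` R) = 1"
    using A4 fin by (simp add: card_Diff_subset)
  then obtain t where t: "A - f ` R = {t}" by (auto simp: card_1_singleton_iff)
  have adj_t: "f w \<in> nbrs G t" if w: "w \<in> R" for w
  proof -
    have "f w \<in> A" using f w by blast
    then have ff: "f (f w) \<in> nbrs G (f w)" "f (f w) \<in> A" using f by blast+
    have "f (f w) \<notin> f ` R"
    proof
      assume "f (f w) \<in> f ` R"
      then obtain w' where "w' \<in> R" "f (f w) = f w'" by blast
      then show False
        using ff f_nonadj[OF w, of w'] nbrs_subset[OF G(1), of "f w"] by (cases "w = w'") auto
    qed
    then have "f (f w) = t" using ff t by blast
    then show ?thesis using ff nbrs_sym by fast
  qed
  have "t \<in> A" using t by blast
  then have "v \<noteq> t" using vA by auto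
  \<comment> \<open>Two neighbours of \<open>t\<close> inside \<open>A\<close> would be common
    neighbours of \<open>v\<close> and \<open>t\<close>.\<close>
  have "f a \<in> nbrs G v \<inter> nbrs G t" "f b \<in> nbrs G v \<inter> nbrs G t"
    using adj_t[of a] adj_t[of b] f(2)[of a] f(2)[of b] R(1) by (auto simp: A_def)
  then have "f a = f b" using C4_free_common_nbrs[OF G \<open>v \<noteq> t\<close>] by blast
  then show False using f_inj[of a b] R by auto
qed

text \<open>In a cubic C4-free graph on 8 vertices every vertex would lie in exactly one triangle,
  although 3 does not divide 8.\<close>

lemma C4_free_8_card_edges:
  assumes G: "simple_graph G" "\<not> contains_subgraph G C4" and n: "card (verts G) = 8"
  shows "card (edges G) \<le> 11"
proof (cases "\<exists>v\<in>verts G. card (nbrs G v) \<ge> 4")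
  case True
  then show ?thesis using C4_free_8_degree_ge_4[OF G n] by blast
next
  case False
  show ?thesis
  proof (rule ccontr)
    assume "\<not> ?thesis"
    \<comment> \<open>At least 12 edges give degree sum at least 24 = 8 * 3, while every degree is
      at most 3.\<close>
    then have "card (verts G) * 3 \<le> (\<Sum>v\<in>verts G. card (nbrs G v))"
      using sum_card_nbrs[OF G(1)] n by simp
    then have cubic: "card (nbrs G v) = 3" if "v \<in> verts G" for v
      using sum_nat_le_eq[of "verts G" "\<lambda>v. card (nbrs G v)" 3] False that
        simple_graph_finite(1)[OF G(1)] by (force simp: not_le)
    have sub: "nbrs G u \<subseteq> verts G - {u}" for u by (rule nbrs_subset[OF G(1)])
    \<comment> \<open>Triangles as vertex sets, so that each is counted once.\<close>
    define C where "C = {{a, b, c} | a b c. b \<in> nbrs G a \<and> c \<in> nbrs G a \<and> c \<in> nbrs G b}"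
    have CV: "C \<subseteq> Pow (verts G)"
    proof
      fix T assume "T \<in> C"
      then obtain a b c where T: "T = {a, b, c}" "b \<in> nbrs G a" "c \<in> nbrs G a"
        by (auto simp: C_def)
      then have "a \<in> nbrs G b" using nbrs_sym by fast
      then show "T \<in> Pow (verts G)" using T sub[of a] sub[of b] by auto
    qed
    have rot: "\<exists>b c. T = {x, b, c} \<and> b \<in> nbrs G x \<and> c \<in> nbrs G x \<and> c \<in> nbrs G b \<and> b \<in> nbrs G c"
      if Tx: "T \<in> C" "x \<in> T" for T x
    proof -
      obtain a b c where T: "T = {a, b, c}" "b \<in> nbrs G a" "c \<in> nbrs G a" "c \<in> nbrs G b"
        using Tx(1) by (auto simp: C_def)
      then have "a \<in> nbrs G b" "a \<in> nbrs G c" "b \<in> nbrs G c" using nbrs_sym by fast+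
      moreover have "T = {b, a, c}" "T = {c, a, b}" using T(1) by auto
      moreover have "x = a \<or> x = b \<or> x = c" using Tx(2) T(1) by simp
      ultimately show ?thesis using T by metis
    qed
    have "v \<in> \<Union>C" if v: "v \<in> verts G" for v
    proof -
      \<comment> \<open>The degrees over \<open>A\<close> sum to 9. Of these, 3 account for the
        edges to \<open>v\<close> and at most 4 for edges to \<open>R\<close>, one per vertex of
        \<open>R\<close>. So some edge lies inside \<open>A\<close>, and it forms a triangle with
        \<open>v\<close>.\<close>
      define A where "A = nbrs G v"
      define R where "R = verts G - insert v A"
      note count = C4_free_nbrs_count[OF G v, folded A_def, folded R_def, unfolded n]
      have A3: "card A = 3" using cubic[OF v] by (simp add: A_def)
      then have "card R = 4" using count(1) by simp
      have "card (nbrs G w \<inter> A) \<le> 1" if "w \<in> R" for w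
        using count(2)[of w] that by (auto simp: R_def)
      then have "(\<Sum>w\<in>R. card (nbrs G w \<inter> A)) \<le> 4"
        using sum_bounded_above[of R "\<lambda>u. card (nbrs G u \<inter> A)" 1] \<open>card R = 4\<close> by simp
      moreover have "(\<Sum>u\<in>A. card (nbrs G u)) = 9"
        using cubic sub[of v] A3 by (simp add: A_def subset_iff)
      ultimately have "(\<Sum>u\<in>A. card (nbrs G u \<inter> A)) \<noteq> 0"
        using count(4) A3 by simp
      then obtain u where "u \<in> A" "card (nbrs G u \<inter> A) \<noteq> 0"
        by (meson sum.neutral)
      then obtain w where "w \<in> nbrs G u" "w \<in> A"
        by (metis card.empty disjoint_iff)
      then have "{v, u, w} \<in> C" using \<open>u \<in> A\<close> by (auto simp: C_def A_def)
      then show ?thesis by blast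
    qed
    then have UC: "\<Union>C = verts G" using CV by blast
    have finC: "finite C"
      using CV simple_graph_finite(1)[OF G(1)] by (meson finite_Pow_iff finite_subset)
    have "3 * card C = card (\<Union>C)"
    proof (rule card_partition)
      show "finite (\<Union>C)" using UC simple_graph_finite(1)[OF G(1)] by simp
      show "card T = 3" if "T \<in> C" for T
      proof -
        obtain a b c where "T = {a, b, c}" "b \<in> nbrs G a" "c \<in> nbrs G a" "c \<in> nbrs G b"
          using \<open>T \<in> C\<close> by (auto simp: C_def)
        moreover from this have "b \<noteq> a" "c \<noteq> a" "c \<noteq> b" using sub by blast+
        ultimately show ?thesis by auto
      qed
      show "T \<inter> T' = {}" if T: "T \<in> C" "T' \<in> C" "T \<noteq> T'" for T T'
      proof (rule ccontr)
        assume "T \<inter> T' \<noteq> {}"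
        then obtain x where x: "x \<in> T" "x \<in> T'" by blast
        obtain a b where ab: "T = {x, a, b}" "a \<in> nbrs G x" "b \<in> nbrs G x" "b \<in> nbrs G a" "a \<in> nbrs G b"
          using rot[OF T(1) x(1)] by blast
        obtain c d where cd: "T' = {x, c, d}" "c \<in> nbrs G x" "d \<in> nbrs G x" "d \<in> nbrs G c" "c \<in> nbrs G d"
          using rot[OF T(2) x(2)] by blast
        have ne: "a \<noteq> b" "c \<noteq> d" "x \<notin> nbrs G x" using ab(4) cd(4) sub by blast+
        have "x \<in> verts G" using x T(1) CV by blast
        \<comment> \<open>A vertex of degree 3 has no room for four distinct neighbours, so two
          triangles at \<open>x\<close> share a second vertex.\<close>
        have "{a, b} \<inter> {c, d} \<noteq> {}"
        proof
          assume "{a, b} \<inter> {c, d} = {}"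
          then have "card {a, b, c, d} = 4" using ne by auto
          moreover have "card {a, b, c, d} \<le> card (nbrs G x)"
            using ab cd finite_subset[OF sub[of x]] simple_graph_finite(1)[OF G(1)]
            by (intro card_mono) auto
          ultimately show False using cubic[OF \<open>x \<in> verts G\<close>] by simp
        qed
        \<comment> \<open>The third vertices of two triangles on the edge between \<open>x\<close>
          and \<open>u\<close> are common neighbours of its ends, hence equal.\<close>
        moreover have same: "u' = w'"
          if "u \<in> nbrs G x" "u' \<in> nbrs G u \<inter> nbrs G x" "w' \<in> nbrs G u \<inter> nbrs G x" for u u' w'
        proof -
          have "u \<noteq> x" using that(1) ne(3) by blast
          then show ?thesis using C4_free_common_nbrs[OF G] that(2,3) by blast
        qed
        ultimately have "{a, b} = {c, d}"
          using same[of a b c] same[of a b d] same[of b a c] same[of b a d] ab cd by auto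
        then show False using T(3) ab(1) cd(1) by simp
      qed
    qed (rule finC)
    then have "3 * card C = 8" using UC n by simp
    then show False by presburger
  qed
qed

section \<open>Comparing the extremal numbers\<close>

lemma planar_free_sizes_8_C4_le: "m \<in> planar_free_sizes 8 C4 \<Longrightarrow> m \<le> 11"
  unfolding planar_free_sizes_def using C4_free_8_card_edges by blast

lemma planar_free_sizes_8_C4_plus_le:
  assumes "m \<in> planar_free_sizes 8 C4_plus"
  shows "m \<le> 12"
  using assms
proof (cases rule: planar_free_sizes_C4_plus_cases)
  case 1
  then show ?thesis using planar_free_sizes_8_C4_le by fastforce
next
  case (2 k)
  then have "k \<le> 4 choose 2" using planar_free_sizes_le_choose[of k 4] by simp
  then show ?thesis using 2 by (simp add: four_choose_two)
qed

text \<open>The range starts at 1 because the descent from 5, 6, 7 ends at 1, 2, 3, where no 4-cycle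
  fits. The excluded 4 and 8 are the orders of K4 and 2K4.\<close>

lemma planar_free_sizes_C4_dominates:
  assumes "m \<in> planar_free_sizes n C4_plus" "n \<ge> 1" "n \<noteq> 4" "n \<noteq> 8"
  shows "\<exists>m'\<in>planar_free_sizes n C4. m \<le> m'"
  using assms
proof (induction n arbitrary: m rule: less_induct)
  case (less n)
  from less.prems(1) show ?case
  proof (cases rule: planar_free_sizes_C4_plus_cases)
    case 1
    then show ?thesis by blast
  next
    case (2 k)
    show ?thesis
    \<comment> \<open>Here n - 4 = 8 is outside the induction hypothesis; the exact bound for 8 and
      the truncated tetrahedron take its place.\<close>
    proof (cases "n = 12")
      case True
      then have "m \<le> 18" using 2 planar_free_sizes_8_C4_plus_le[of k] by simp
      then show ?thesis using size12_C4 True by blast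
    next
      case False
      obtain k' where k': "k' \<in> planar_free_sizes (n - 4) C4" "k \<le> k'"
        using less.IH[OF _ 2(2)] 2(1) less.prems(2-4) False by fastforce
      have "k' + 6 \<in> planar_free_sizes (n - 4 + 4) C4"
        using planar_free_sizes_C4_add_bowtie[OF k'(1)] 2(1) less.prems(3) by simp
      then show ?thesis using 2 k'(2) by (intro bexI[of _ "k' + 6"]) simp_all
    qed
  qed
qed

lemma ex_planar_upper: "m \<in> planar_free_sizes n H \<Longrightarrow> m \<le> ex_planar n H"
  unfolding ex_planar_def using finite_planar_free_sizes by (rule Max_ge)

lemma ex_planar_attained: "edges H \<noteq> {} \<Longrightarrow> ex_planar n H \<in> planar_free_sizes n H"
  unfolding ex_planar_def using finite_planar_free_sizes planar_free_sizes_nonempty by (rule Max_in)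

theorem theorem3p4:
  fixes n :: nat
  assumes "n \<ge> 5"
  shows "(n \<noteq> 8 \<longrightarrow> ex_planar n C4_plus = ex_planar n C4) \<and>
         ex_planar 8 C4_plus = ex_planar 8 C4 + 1 \<and> ex_planar 8 C4 + 1 = 12"
proof (intro conjI impI)
  have ne: "edges C4 \<noteq> {}" "edges C4_plus \<noteq> {}"
    by (simp_all add: C4_def C4_plus_def)
  have C4: "ex_planar k C4 \<in> planar_free_sizes k C4" for k
    by (rule ex_planar_attained[OF ne(1)])
  have C4p: "ex_planar k C4_plus \<in> planar_free_sizes k C4_plus" for k
    by (rule ex_planar_attained[OF ne(2)])
  show "ex_planar n C4_plus = ex_planar n C4" if "n \<noteq> 8"
  proof (rule antisym)
    obtain m where "m \<in> planar_free_sizes n C4" "ex_planar n C4_plus \<le> m"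
      using planar_free_sizes_C4_dominates[OF C4p[of n]] assms \<open>n \<noteq> 8\<close> by auto
    then show "ex_planar n C4_plus \<le> ex_planar n C4"
      using ex_planar_upper le_trans by blast
    show "ex_planar n C4 \<le> ex_planar n C4_plus"
      using C4[of n] planar_free_sizes_C4_subset ex_planar_upper by blast
  qed
  have 8: "ex_planar 8 C4 = 11"
    using planar_free_sizes_8_C4_le[OF C4] ex_planar_upper[OF size8_C4] by (rule antisym)
  moreover have "ex_planar 8 C4_plus = 12"
    using planar_free_sizes_8_C4_plus_le[OF C4p] ex_planar_upper[OF size8_C4_plus] by (rule antisym)
  ultimately show "ex_planar 8 C4_plus = ex_planar 8 C4 + 1" "ex_planar 8 C4 + 1 = 12"
    by simp_all
qed

end
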